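(* Let $G(x',x_3)=G(x')=r^{2\delta}\big(\mathrm{Id}_3+(r^2-1)\vec n\otimes\vec n\big)$ and assume that the director field is planar: $\vec n=(n_1,n_2,0)^T$ with $n=(n_1,n_2):\bar\Omega\to S^1$. Then the following conditions are equivalent: (i) the metric $G$ is immersable, i.e. $G=(\nabla u)^T\nabla u$ for some smooth $u:\Omega^1\to\mathbb{R}^3$; (ii) the Gaussian curvature $\kappa(\mathrm{Id}_2+(r^2-1)n\otimes n)$ of the two-dimensional metric $\mathrm{Id}_2+(r^2-1)n\otimes n$ vanishes identically in $\Omega$; (iii) $\mathrm{curl}^T\mathrm{curl}\,G_{2\times2}=0$ in $\Omega$; (iv) the following curvatures of $G$ vanish: $R^3_{112}=R^3_{221}=R_{1212}=0$ in $\Omega$.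
   Context: $\Omega\subset\mathbb{R}^2$ is an open, bounded, smooth and simply connected set; $\Omega^1=\Omega\times(-\frac12,\frac12)$, with points $(x',x_3)$. The constants are $r=\Lambda^{\nu+1}$ and $\delta=-\frac{\nu}{\nu+1}$, where $\Lambda\in(0,1)\cup(1,\infty)$ (elongation or contraction factor) and $\frac12<\nu<2$ are constants. The director field $\vec n$ is smooth on $\bar\Omega$, with $|\vec n|=1$. $G_{2\times2}$ is the principal (upper-left) $2\times2$ block of $G$. For a symmetric $2\times2$ matrix field $F$, $\mathrm{curl}^T\mathrm{curl}\,F=\partial_{22}F_{11}-2\partial_{12}F_{12}+\partial_{11}F_{22}$. With $[G^{ij}]=G^{-1}$ (and $\partial_3G=0$), $\Gamma^i_{kl}=\frac12\sum_{m=1}^3G^{im}(\partial_lG_{mk}+\partial_kG_{ml}-\partial_mG_{kl})$, $R^s_{ijk}=\partial_j\Gamma^s_{ik}-\partial_k\Gamma^s_{ij}+\sum_{m=1}^3\Gamma^s_{jm}\Gamma^m_{ik}-\sum_{m=1}^3\Gamma^s_{km}\Gamma^m_{ij}$, and $R_{sijk}=\sum_{m=1}^3G_{sm}R^m_{ijk}$. *)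

theory Defs
  imports "HOL-Analysis.Analysis"
begin

definition pderiv_at :: "'k::finite \<Rightarrow> (real^'k \<Rightarrow> 'b::real_normed_vector) \<Rightarrow> real^'k \<Rightarrow> 'b" where
  "pderiv_at k f x = frechet_derivative f (at x) (axis k 1)"

definition iter_pderiv :: "'k::finite list \<Rightarrow> (real^'k \<Rightarrow> 'b::real_normed_vector) \<Rightarrow> real^'k \<Rightarrow> 'b" where
  "iter_pderiv ks f = foldr pderiv_at ks f"

text \<open>\<open>C\<^sup>\<infinity>(S)\<close>; meaningful for open \<open>S\<close> only.\<close>

definition smooth_on :: "(real^'k::finite) set \<Rightarrow> (real^'k \<Rightarrow> 'b::real_normed_vector) \<Rightarrow> bool" where
  "smooth_on S f \<longleftrightarrow> (\<forall>ks. iter_pderiv ks f differentiable_on S)"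

text \<open>Smoothness on the closure of an open set \<open>S\<close>: partial derivatives of all orders exist in \<open>S\<close>
  and extend continuously to \<open>closure S\<close>, where \<open>f\<close> itself agrees with its continuous extension.\<close>

definition smooth_on_closure :: "(real^'k::finite) set \<Rightarrow> (real^'k \<Rightarrow> 'b::real_normed_vector) \<Rightarrow> bool" where
  "smooth_on_closure S f \<longleftrightarrow> smooth_on S f \<and> continuous_on (closure S) f \<and>
     (\<forall>ks. \<exists>g. continuous_on (closure S) g \<and> (\<forall>x\<in>S. g x = iter_pderiv ks f x))"

text \<open>Near each boundary point \<open>S\<close> is a strict sublevel set of a smooth function without critical
  points; in particular \<open>S\<close> lies locally on one side of its boundary.\<close>

definition smooth_boundary :: "(real^'k::finite) set \<Rightarrow> bool" where
  "smooth_boundary S \<longleftrightarrow> (\<forall>p\<in>frontier S. \<exists>U (\<rho> :: real^'k \<Rightarrow> real).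
     open U \<and> p \<in> U \<and> smooth_on U \<rho> \<and> (\<forall>x\<in>U. \<exists>k. pderiv_at k \<rho> x \<noteq> 0) \<and>
     S \<inter> U = {x\<in>U. \<rho> x < 0})"

definition tensor :: "real^'n \<Rightarrow> real^'n \<Rightarrow> real^'n^'n" (infixr "\<otimes>" 75) where
  "v \<otimes> w = (\<chi> i j. v $ i * w $ j)"

definition planar_part :: "real^3 \<Rightarrow> real^2" where
  "planar_part x = vector [x $ 1, x $ 2]"

definition slab :: "(real^2) set \<Rightarrow> (real^3) set" where
  "slab \<Omega> = {x. planar_part x \<in> \<Omega> \<and> x $ 3 \<in> {-1/2<..<1/2}}"

definition principal_block :: "real^3^3 \<Rightarrow> real^2^2" where
  "principal_block A = vector [vector [A $ 1 $ 1, A $ 1 $ 2], vector [A $ 2 $ 1, A $ 2 $ 2]]"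

text \<open>\<open>christoffel g i k l\<close> is \<open>\<Gamma>\<^sup>i\<^sub>k\<^sub>l\<close>.\<close>

definition christoffel :: "(real^'k::finite \<Rightarrow> real^'k^'k) \<Rightarrow> 'k \<Rightarrow> 'k \<Rightarrow> 'k \<Rightarrow> real^'k \<Rightarrow> real" where
  "christoffel g i k l x = 1/2 * (\<Sum>m\<in>UNIV. matrix_inv (g x) $ i $ m *
     (pderiv_at l (\<lambda>y. g y $ m $ k) x + pderiv_at k (\<lambda>y. g y $ m $ l) x
        - pderiv_at m (\<lambda>y. g y $ k $ l) x))"

text \<open>\<open>riemann_mixed g s i j k\<close> is \<open>R\<^sup>s\<^sub>i\<^sub>j\<^sub>k\<close>, \<open>riemann g s i j k\<close> is \<open>R\<^sub>s\<^sub>i\<^sub>j\<^sub>k\<close>.\<close>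

definition riemann_mixed :: "(real^'k::finite \<Rightarrow> real^'k^'k) \<Rightarrow> 'k \<Rightarrow> 'k \<Rightarrow> 'k \<Rightarrow> 'k \<Rightarrow> real^'k \<Rightarrow> real" where
  "riemann_mixed g s i j k x =
     pderiv_at j (christoffel g s i k) x - pderiv_at k (christoffel g s i j) x
     + (\<Sum>m\<in>UNIV. christoffel g s j m x * christoffel g m i k x)
     - (\<Sum>m\<in>UNIV. christoffel g s k m x * christoffel g m i j x)"

definition riemann :: "(real^'k::finite \<Rightarrow> real^'k^'k) \<Rightarrow> 'k \<Rightarrow> 'k \<Rightarrow> 'k \<Rightarrow> 'k \<Rightarrow> real^'k \<Rightarrow> real" where
  "riemann g s i j k x = (\<Sum>m\<in>UNIV. g x $ s $ m * riemann_mixed g m i j k x)"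

text \<open>With the above index convention \<open>R\<^sub>1\<^sub>2\<^sub>1\<^sub>2 / det g\<close> is positive for the round sphere.\<close>

definition gauss_curvature :: "(real^2 \<Rightarrow> real^2^2) \<Rightarrow> real^2 \<Rightarrow> real" where
  "gauss_curvature g x = riemann g 1 2 1 2 x / det (g x)"

definition curlT_curl :: "(real^2 \<Rightarrow> real^2^2) \<Rightarrow> real^2 \<Rightarrow> real" where
  "curlT_curl F x = iter_pderiv [2, 2] (\<lambda>y. F y $ 1 $ 1) x
     - 2 * iter_pderiv [1, 2] (\<lambda>y. F y $ 1 $ 2) x
     + iter_pderiv [1, 1] (\<lambda>y. F y $ 2 $ 2) x"

definition immersable :: "(real^3) set \<Rightarrow> (real^3 \<Rightarrow> real^3^3) \<Rightarrow> bool" where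
  "immersable S g \<longleftrightarrow> (\<exists>u :: real^3 \<Rightarrow> real^3. smooth_on S u \<and>
     (\<forall>x\<in>S. g x = transpose (matrix (frechet_derivative u (at x))) **
                  matrix (frechet_derivative u (at x))))"

end

theory Submission
  imports Defs "HOL-Complex_Analysis.Riemann_Mapping"
begin

text \<open>Write \<open>n = (cos \<theta>, sin \<theta>)\<close>, of which only \<open>t = \<nabla>\<theta> = n\<^sub>1 \<nabla>n\<^sub>2 - n\<^sub>2 \<nabla>n\<^sub>1\<close> is needed, and
  \<open>g = Id + (r\<^sup>2 - 1) n \<otimes> n\<close>. The quadratic Christoffel terms in \<open>R\<^sub>1\<^sub>2\<^sub>1\<^sub>2\<close> cancel for \<open>g\<close>, so
  \<open>R\<^sub>1\<^sub>2\<^sub>1\<^sub>2 = - curl\<^sup>T curl g / 2\<close>; the Christoffel symbols of \<open>G\<close> are those of \<open>g\<close> or zero. This relates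
  (ii), (iii) and (iv). If \<open>G\<close> is immersed by \<open>u\<close>, then \<open>\<partial>\<^sub>k\<partial>\<^sub>l u = \<Gamma>\<^sup>i\<^sub>k\<^sub>l \<partial>\<^sub>i u\<close> and commuting third
  derivatives makes all curvatures vanish. Conversely, the connection form of the coframe
  \<open>\<omega>\<^sub>1 = r (n\<^sub>1 dx + n\<^sub>2 dy)\<close>, \<open>\<omega>\<^sub>2 = - n\<^sub>2 dx + n\<^sub>1 dy\<close> is closed when \<open>g\<close> is flat; rotating the coframe by a potential of
  it gives two closed forms, whose potentials are flat coordinates. Potentials exist on a simply
  connected planar domain because the Riemann mapping reduces the Poincare lemma to a convex one.\<close>

section \<open>Partial derivatives and smooth functions\<close>

lemma pderiv_at_eq: "(f has_derivative D) (at x) \<Longrightarrow> pderiv_at k f x = D (axis k 1)"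
  unfolding pderiv_at_def by (metis frechet_derivative_at)

text \<open>No differentiability is assumed: functions that agree near \<open>x\<close> have the
  same candidates for \<open>frechet_derivative\<close>, so the choice operator returns the same
  value for both, even where no derivative exists.\<close>

lemma pderiv_at_cong:
  assumes "open S" "x \<in> S" "\<And>y. y \<in> S \<Longrightarrow> f y = g y"
  shows "pderiv_at k f x = pderiv_at k g x"
proof -
  have "(f has_derivative D) (at x) \<longleftrightarrow> (g has_derivative D) (at x)" for D
    using assms has_derivative_transform_within_open[of f D x UNIV S g]
      has_derivative_transform_within_open[of g D x UNIV S f] by auto
  then show ?thesis unfolding pderiv_at_def frechet_derivative_def by simp
qed

lemma has_derivative_pderiv:
  fixes f :: "real^'k::finite \<Rightarrow> 'b::real_normed_vector"
  assumes "f differentiable (at x)"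
  shows "(f has_derivative (\<lambda>h. \<Sum>k\<in>UNIV. h $ k *\<^sub>R pderiv_at k f x)) (at x)"
proof -
  have D: "(f has_derivative frechet_derivative f (at x)) (at x)"
    using assms frechet_derivative_works by blast
  then interpret linear "frechet_derivative f (at x)"
    using has_derivative_linear by blast
  have "frechet_derivative f (at x) h = (\<Sum>k\<in>UNIV. h $ k *\<^sub>R pderiv_at k f x)" for h
  proof -
    have "h = (\<Sum>k\<in>UNIV. h $ k *\<^sub>R axis k 1)"
      using basis_expansion[of h] by (simp add: scalar_mult_eq_scaleR)
    then have "frechet_derivative f (at x) h = frechet_derivative f (at x) (\<Sum>k\<in>UNIV. h $ k *\<^sub>R axis k 1)"
      by (rule arg_cong)
    also have "\<dots> = (\<Sum>k\<in>UNIV. h $ k *\<^sub>R pderiv_at k f x)"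
      by (simp add: sum scale pderiv_at_def)
    finally show ?thesis .
  qed
  then have "frechet_derivative f (at x) = (\<lambda>h. \<Sum>k\<in>UNIV. h $ k *\<^sub>R pderiv_at k f x)" by blast
  then show ?thesis using D by simp
qed

lemma pderiv_at_const [simp]: "pderiv_at k (\<lambda>y. c) x = 0"
  by (simp add: pderiv_at_def)

lemma pderiv_at_add:
  assumes "f differentiable at x" "g differentiable at x"
  shows "pderiv_at k (\<lambda>y. f y + g y) x = pderiv_at k f x + pderiv_at k g x"
  using pderiv_at_eq[OF has_derivative_add[OF assms[unfolded frechet_derivative_works]]]
  by (simp add: pderiv_at_def)

lemma pderiv_at_minus:
  assumes "f differentiable at x"
  shows "pderiv_at k (\<lambda>y. - f y) x = - pderiv_at k f x"
  using pderiv_at_eq[OF has_derivative_minus[OF assms[unfolded frechet_derivative_works]]]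
  by (simp add: pderiv_at_def)

lemma pderiv_at_diff:
  assumes "f differentiable at x" "g differentiable at x"
  shows "pderiv_at k (\<lambda>y. f y - g y) x = pderiv_at k f x - pderiv_at k g x"
  using pderiv_at_eq[OF has_derivative_diff[OF assms[unfolded frechet_derivative_works]]]
  by (simp add: pderiv_at_def)

lemma pderiv_at_bilinear:
  assumes "bounded_bilinear m" "f differentiable at x" "g differentiable at x"
  shows "pderiv_at k (\<lambda>y. m (f y) (g y)) x = m (pderiv_at k f x) (g x) + m (f x) (pderiv_at k g x)"
  using pderiv_at_eq[OF bounded_bilinear.FDERIV[OF assms(1) assms(2,3)[unfolded frechet_derivative_works]]]
  by (simp add: pderiv_at_def)

lemma pderiv_at_mult:
  fixes f g :: "real^'k::finite \<Rightarrow> 'b::real_normed_algebra"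
  assumes "f differentiable at x" "g differentiable at x"
  shows "pderiv_at k (\<lambda>y. f y * g y) x = pderiv_at k f x * g x + f x * pderiv_at k g x"
  by (rule pderiv_at_bilinear[OF bounded_bilinear_mult assms])

lemma pderiv_at_divide:
  fixes f :: "real^'k::finite \<Rightarrow> real"
  assumes "f differentiable at x"
  shows "pderiv_at k (\<lambda>y. f y / c) x = pderiv_at k f x / c"
  using pderiv_at_mult[OF assms differentiable_const[of "1 / c"]] by simp

lemma pderiv_at_sum:
  assumes "\<And>i. i \<in> A \<Longrightarrow> f i differentiable at x"
  shows "pderiv_at k (\<lambda>y. \<Sum>i\<in>A. f i y) x = (\<Sum>i\<in>A. pderiv_at k (f i) x)"
  using pderiv_at_eq[OF has_derivative_sum[OF assms[unfolded frechet_derivative_works]]]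
  by (simp add: pderiv_at_def)

lemma pderiv_at_bounded_linear:
  assumes "bounded_linear l" "f differentiable at x"
  shows "pderiv_at k (\<lambda>y. l (f y)) x = l (pderiv_at k f x)"
  using pderiv_at_eq[OF bounded_linear.has_derivative[OF assms(1) assms(2)[unfolded frechet_derivative_works]]]
  by (simp add: pderiv_at_def)

lemmas pderiv_at_nth = pderiv_at_bounded_linear[OF bounded_linear_vec_nth]

lemma pderiv_at_component: "pderiv_at k (\<lambda>y. y $ i) x = (if i = k then 1 else 0)"
  by (subst pderiv_at_eq[OF bounded_linear_imp_has_derivative[OF bounded_linear_vec_nth]])
    (simp add: axis_def)

lemma pderiv_at_DERIV:
  fixes f :: "real^'k::finite \<Rightarrow> real"
  assumes "(g has_field_derivative D) (at (f x))" "f differentiable at x"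
  shows "pderiv_at k (\<lambda>y. g (f y)) x = D * pderiv_at k f x"
  using pderiv_at_eq[OF has_derivative_compose[OF assms(2)[unfolded frechet_derivative_works]
        assms(1)[unfolded has_field_derivative_def]]]
  by (simp add: pderiv_at_def)

lemma iter_pderiv_Nil [simp]: "iter_pderiv [] f = f"
  and iter_pderiv_Cons [simp]: "iter_pderiv (k # ks) f = pderiv_at k (iter_pderiv ks f)"
  and iter_pderiv_snoc: "iter_pderiv (ks @ [k]) f = iter_pderiv ks (pderiv_at k f)"
  by (simp_all add: iter_pderiv_def)

section \<open>Iterated partial derivatives and closure properties of smooth functions\<close>

lemma iter_pderiv_cong:
  assumes "open S" "\<And>y. y \<in> S \<Longrightarrow> f y = g y" "x \<in> S"
  shows "iter_pderiv ks f x = iter_pderiv ks g x"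
  using assms(3)
proof (induction ks arbitrary: x)
  case (Cons k ks)
  show ?case using pderiv_at_cong[OF assms(1) Cons.prems Cons.IH] by simp
qed (simp add: assms)

lemma differentiable_on_cong:
  assumes "open S" "\<And>y. y \<in> S \<Longrightarrow> f y = g y" "f differentiable_on S"
  shows "g differentiable_on S"
  unfolding differentiable_on_def
proof
  fix x assume "x \<in> S"
  then show "g differentiable at x within S"
    using assms differentiable_transform_within[of f x S 1 g] by (auto simp: differentiable_on_def)
qed

lemma smooth_on_cong:
  assumes "open S" "\<And>y. y \<in> S \<Longrightarrow> f y = g y" "smooth_on S f"
  shows "smooth_on S g"
  unfolding smooth_on_def
proof
  fix ks show "iter_pderiv ks g differentiable_on S"
    by (rule differentiable_on_cong[OF assms(1) iter_pderiv_cong[OF assms(1,2)]])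
      (use assms(3) in \<open>auto simp: smooth_on_def\<close>)
qed

lemma smooth_on_imp_differentiable: "smooth_on S f \<Longrightarrow> open S \<Longrightarrow> x \<in> S \<Longrightarrow> f differentiable at x"
  unfolding smooth_on_def by (metis differentiable_on_eq_differentiable_at iter_pderiv_Nil)

lemma smooth_on_pderiv: "smooth_on S f \<Longrightarrow> smooth_on S (pderiv_at k f)"
  unfolding smooth_on_def by (metis iter_pderiv_snoc)

text \<open>The list is peeled at its inner end, so that the derivative taken first is replaced by a
  member of \<open>P\<close> before the induction hypothesis applies. That member is compared with
  the derivative on \<open>S\<close> only, since values off \<open>S\<close> are
  unspecified.\<close>

lemma smooth_on_coinduct:
  assumes "P f" "open S"
    and diff: "\<And>f x. P f \<Longrightarrow> x \<in> S \<Longrightarrow> f differentiable at x"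
    and deriv: "\<And>f k. P f \<Longrightarrow> \<exists>g. P g \<and> (\<forall>x\<in>S. g x = pderiv_at k f x)"
  shows "smooth_on S f"
  unfolding smooth_on_def
proof
  fix ks show "iter_pderiv ks f differentiable_on S"
    using assms(1)
  proof (induction ks arbitrary: f rule: rev_induct)
    case (snoc k ks)
    then obtain g where g: "P g" "\<forall>x\<in>S. g x = pderiv_at k f x" using deriv by blast
    show ?case unfolding iter_pderiv_snoc
      by (rule differentiable_on_cong[OF assms(2) iter_pderiv_cong[OF assms(2)] snoc.IH[OF g(1)]])
        (use g(2) in auto)
  qed (simp add: differentiable_on_eq_differentiable_at diff assms(2))
qed

text \<open>Being \<open>f\<close> or a smooth function is an invariant closed under differentiation
  up to equality on \<open>S\<close>. This serves for potentials, of which only the first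
  derivatives are known.\<close>

lemma smooth_on_pderivI:
  assumes "open S" "\<And>x. x \<in> S \<Longrightarrow> f differentiable at x"
    and "\<And>k. \<exists>g. smooth_on S g \<and> (\<forall>x\<in>S. g x = pderiv_at k f x)"
  shows "smooth_on S f"
proof (rule smooth_on_coinduct[where P = "\<lambda>h. h = f \<or> smooth_on S h"])
  fix h x assume "h = f \<or> smooth_on S h" "x \<in> S"
  then show "h differentiable at x"
    using assms(2) smooth_on_imp_differentiable[OF _ assms(1)] by auto
next
  fix h k assume "h = f \<or> smooth_on S h"
  then show "\<exists>g. (g = f \<or> smooth_on S g) \<and> (\<forall>x\<in>S. g x = pderiv_at k h x)"
  proof
    assume "h = f" then show ?thesis using assms(3)[of k] by auto
  next
    assume "smooth_on S h"
    then show ?thesis by (intro exI[of _ "pderiv_at k h"]) (simp add: smooth_on_pderiv)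
  qed
qed (use assms in auto)

text \<open>Closed under differentiation up to equality on \<open>S\<close>, so coinduction applies to it as a whole;
  this yields all closure properties of \<open>smooth_on\<close> from a single induction.\<close>

inductive smooth_alg :: "(real^'k::finite) set \<Rightarrow> (real^'k \<Rightarrow> real) \<Rightarrow> bool" for S where
  base: "smooth_on S f \<Longrightarrow> smooth_alg S f"
| const: "smooth_alg S (\<lambda>x. c)"
| add: "smooth_alg S f \<Longrightarrow> smooth_alg S g \<Longrightarrow> smooth_alg S (\<lambda>x. f x + g x)"
| mult: "smooth_alg S f \<Longrightarrow> smooth_alg S g \<Longrightarrow> smooth_alg S (\<lambda>x. f x * g x)"
| sin: "smooth_on S f \<Longrightarrow> smooth_alg S (\<lambda>x. sin (f x))"
| cos: "smooth_on S f \<Longrightarrow> smooth_alg S (\<lambda>x. cos (f x))"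

lemma smooth_alg_differentiable:
  assumes "smooth_alg S f" "open S" "x \<in> S"
  shows "f differentiable at x"
  using assms(1)
proof induction
  case (sin f)
  show ?case
    by (rule differentiableI[OF has_derivative_sin[OF
            smooth_on_imp_differentiable[OF sin assms(2,3), unfolded frechet_derivative_works]]])
next
  case (cos f)
  show ?case
    by (rule differentiableI[OF has_derivative_cos[OF
            smooth_on_imp_differentiable[OF cos assms(2,3), unfolded frechet_derivative_works]]])
qed (simp_all add: smooth_on_imp_differentiable[OF _ assms(2,3)])

lemma smooth_alg_pderiv:
  assumes "smooth_alg S f" "open S"
  shows "\<exists>g. smooth_alg S g \<and> (\<forall>x\<in>S. g x = pderiv_at k f x)"
  using assms(1)
proof induction
  case (base f)
  show ?case by (intro exI[of _ "pderiv_at k f"]) (simp add: smooth_alg.base smooth_on_pderiv base)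
next
  case (const c)
  show ?case by (intro exI[of _ "\<lambda>x. 0"]) (simp add: smooth_alg.const)
next
  case (add f g)
  then obtain f' g' where f': "smooth_alg S f'" "\<forall>x\<in>S. f' x = pderiv_at k f x"
    and g': "smooth_alg S g'" "\<forall>x\<in>S. g' x = pderiv_at k g x" by blast
  show ?case using f' g'
    by (intro exI[of _ "\<lambda>x. f' x + g' x"])
      (simp add: pderiv_at_add smooth_alg_differentiable[OF add.hyps(1) assms(2)]
        smooth_alg_differentiable[OF add.hyps(2) assms(2)] smooth_alg.add)
next
  case (mult f g)
  then obtain f' g' where f': "smooth_alg S f'" "\<forall>x\<in>S. f' x = pderiv_at k f x"
    and g': "smooth_alg S g'" "\<forall>x\<in>S. g' x = pderiv_at k g x" by blast
  show ?case using f' g'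
    by (intro exI[of _ "\<lambda>x. f' x * g x + f x * g' x"])
      (simp add: pderiv_at_mult smooth_alg_differentiable[OF mult.hyps(1) assms(2)]
        smooth_alg_differentiable[OF mult.hyps(2) assms(2)] smooth_alg.add smooth_alg.mult mult.hyps)
next
  case (sin f)
  have "smooth_alg S (\<lambda>x. cos (f x) * pderiv_at k f x)"
    using sin by (intro smooth_alg.mult smooth_alg.cos smooth_alg.base smooth_on_pderiv)
  then show ?case
    by (intro exI[of _ "\<lambda>x. cos (f x) * pderiv_at k f x"])
      (simp add: pderiv_at_DERIV[OF DERIV_sin smooth_on_imp_differentiable[OF sin assms(2)]])
next
  case (cos f)
  have "smooth_alg S (\<lambda>x. -1 * (sin (f x) * pderiv_at k f x))"
    using cos by (intro smooth_alg.const smooth_alg.mult smooth_alg.sin smooth_alg.base smooth_on_pderiv)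
  then show ?case
    by (intro exI[of _ "\<lambda>x. -1 * (sin (f x) * pderiv_at k f x)"])
      (simp add: pderiv_at_DERIV[OF DERIV_cos smooth_on_imp_differentiable[OF cos assms(2)]])
qed

lemma smooth_alg_imp_smooth_on:
  assumes "smooth_alg S f" "open S"
  shows "smooth_on S f"
  by (rule smooth_on_coinduct[where P = "smooth_alg S", OF assms])
    (simp_all add: smooth_alg_pderiv smooth_alg_differentiable assms(2))

context
  fixes S :: "(real^'k::finite) set" and f g :: "real^'k \<Rightarrow> real"
  assumes S: "open S"
begin

lemma smooth_on_const: "smooth_on S (\<lambda>x. c :: real)"
  by (simp add: S smooth_alg.const smooth_alg_imp_smooth_on)

lemma smooth_on_sin: "smooth_on S f \<Longrightarrow> smooth_on S (\<lambda>x. sin (f x))"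
  by (simp add: S smooth_alg.sin smooth_alg_imp_smooth_on)

lemma smooth_on_cos: "smooth_on S f \<Longrightarrow> smooth_on S (\<lambda>x. cos (f x))"
  by (simp add: S smooth_alg.cos smooth_alg_imp_smooth_on)

lemma smooth_on_add: "smooth_on S f \<Longrightarrow> smooth_on S g \<Longrightarrow> smooth_on S (\<lambda>x. f x + g x)"
  by (simp add: S smooth_alg.add smooth_alg.base smooth_alg_imp_smooth_on)

lemma smooth_on_mult: "smooth_on S f \<Longrightarrow> smooth_on S g \<Longrightarrow> smooth_on S (\<lambda>x. f x * g x)"
  by (simp add: S smooth_alg.mult smooth_alg.base smooth_alg_imp_smooth_on)

end

lemma smooth_on_minus:
  fixes f :: "real^'k::finite \<Rightarrow> real"
  shows "open S \<Longrightarrow> smooth_on S f \<Longrightarrow> smooth_on S (\<lambda>x. - f x)"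
  using smooth_on_mult[OF _ smooth_on_const[of S "-1"], of f] by simp

lemma smooth_on_diff:
  fixes f g :: "real^'k::finite \<Rightarrow> real"
  shows "open S \<Longrightarrow> smooth_on S f \<Longrightarrow> smooth_on S g \<Longrightarrow> smooth_on S (\<lambda>x. f x - g x)"
  using smooth_on_add[OF _ _ smooth_on_minus, of S f g] by simp

lemma smooth_on_sum:
  fixes f :: "'i \<Rightarrow> real^'k::finite \<Rightarrow> real"
  assumes "open S" "\<And>i. i \<in> A \<Longrightarrow> smooth_on S (f i)"
  shows "smooth_on S (\<lambda>x. \<Sum>i\<in>A. f i x)"
  using assms(2)
  by (induction A rule: infinite_finite_induct) (auto simp: smooth_on_const smooth_on_add assms(1))

lemmas smooth_on_intros = smooth_on_const smooth_on_sin smooth_on_cos smooth_on_add smooth_on_mult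
  smooth_on_minus smooth_on_diff smooth_on_sum smooth_on_pderiv

lemma smooth_on_nth:
  fixes f :: "real^'k::finite \<Rightarrow> real^'m"
  assumes "open S" "smooth_on S f"
  shows "smooth_on S (\<lambda>x. f x $ i)"
proof (rule smooth_on_coinduct[where P = "\<lambda>h. \<exists>f :: real^'k \<Rightarrow> real^'m. smooth_on S f \<and> h = (\<lambda>x. f x $ i)"])
  fix h x assume "\<exists>f :: real^'k \<Rightarrow> real^'m. smooth_on S f \<and> h = (\<lambda>x. f x $ i)" and x: "x \<in> S"
  then obtain f :: "real^'k \<Rightarrow> real^'m" where f: "smooth_on S f" and h: "h = (\<lambda>x. f x $ i)" by blast
  show "h differentiable at x"
    unfolding h by (rule differentiableI[OF bounded_linear.has_derivative[OF bounded_linear_vec_nth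
            smooth_on_imp_differentiable[OF f assms(1) x, unfolded frechet_derivative_works]]])
next
  fix h k assume "\<exists>f :: real^'k \<Rightarrow> real^'m. smooth_on S f \<and> h = (\<lambda>x. f x $ i)"
  then obtain f :: "real^'k \<Rightarrow> real^'m" where f: "smooth_on S f" and h: "h = (\<lambda>x. f x $ i)" by blast
  have "pderiv_at k f x $ i = pderiv_at k h x" if "x \<in> S" for x
    unfolding h by (rule pderiv_at_nth[OF smooth_on_imp_differentiable[OF f assms(1) that], symmetric])
  then show "\<exists>g. (\<exists>f :: real^'k \<Rightarrow> real^'m. smooth_on S f \<and> g = (\<lambda>x. f x $ i)) \<and> (\<forall>x\<in>S. g x = pderiv_at k h x)"
    by (intro exI[of _ "\<lambda>x. pderiv_at k f x $ i"] conjI exI[of _ "pderiv_at k f"] smooth_on_pderiv[OF f])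
       simp_all
qed (use assms in auto)

lemma differentiable_at_componentwise:
  fixes f :: "'a::real_normed_vector \<Rightarrow> real^'m"
  assumes "\<And>i. (\<lambda>x. f x $ i) differentiable at x"
  shows "f differentiable at x"
  using assms differentiable_componentwise_within[of f x UNIV]
  by (auto simp: Basis_vec_def inner_axis)

text \<open>The algebra of smooth functions is real-valued; vector-valued maps assembled from it,
  such as the immersion, become smooth in this way.\<close>

lemma smooth_on_componentwise:
  fixes f :: "real^'k::finite \<Rightarrow> real^'m"
  assumes S: "open S" and "\<And>i. smooth_on S (\<lambda>x. f x $ i)"
  shows "smooth_on S f"
proof (rule smooth_on_coinduct[where P = "\<lambda>f. \<forall>i. smooth_on S (\<lambda>x. f x $ i)"])
  fix f :: "real^'k::finite \<Rightarrow> real^'m" and x assume f: "\<forall>i. smooth_on S (\<lambda>x. f x $ i)" and "x \<in> S"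
  then show "f differentiable at x"
    using S by (intro differentiable_at_componentwise smooth_on_imp_differentiable[of S]) auto
next
  fix f :: "real^'k::finite \<Rightarrow> real^'m" and k assume f: "\<forall>i. smooth_on S (\<lambda>x. f x $ i)"
  have d: "f differentiable at x" if "x \<in> S" for x
    using f that S by (intro differentiable_at_componentwise smooth_on_imp_differentiable[of S]) auto
  have "smooth_on S (\<lambda>x. pderiv_at k f x $ i)" for i
    by (rule smooth_on_cong[OF S pderiv_at_nth[OF d]]) (auto intro: smooth_on_pderiv[OF spec[OF f]])
  then show "\<exists>g. (\<forall>i. smooth_on S (\<lambda>x. g x $ i)) \<and> (\<forall>x\<in>S. g x = pderiv_at k f x)"
    by (intro exI[of _ "pderiv_at k f"]) simp
qed (use assms in auto)

section \<open>Symmetry of second partial derivatives\<close>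

text \<open>The mean value theorem is applied twice: to the increment of \<open>f\<close> in
  direction \<open>j\<close> as a function of the position along \<open>i\<close>, then to
  \<open>pderiv_at i f\<close> along \<open>j\<close>. The bound \<open>2 * t < e\<close> keeps all
  points in the ball, also when \<open>i = j\<close>.\<close>

lemma second_difference_mvt:
  fixes f :: "real^'k::finite \<Rightarrow> real"
  assumes f: "smooth_on (ball x e) f" and t: "0 < t" "2 * t < e"
  shows "\<exists>\<xi>\<in>{0<..<t}. \<exists>\<eta>\<in>{0<..<t}.
    f (x + t *\<^sub>R axis i 1 + t *\<^sub>R axis j 1) - f (x + t *\<^sub>R axis i 1) - f (x + t *\<^sub>R axis j 1) + f x
    = t * t * pderiv_at j (pderiv_at i f) (x + \<xi> *\<^sub>R axis i 1 + \<eta> *\<^sub>R axis j 1)"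
proof -
  have line: "((\<lambda>s. h (z + s *\<^sub>R axis k 1)) has_real_derivative pderiv_at k h (z + s *\<^sub>R axis k 1)) (at s)"
    if "smooth_on (ball x e) h" "z + s *\<^sub>R axis k 1 \<in> ball x e" for h :: "real^'k \<Rightarrow> real" and z s k
  proof -
    have "(h has_derivative frechet_derivative h (at (z + s *\<^sub>R axis k 1))) (at (z + s *\<^sub>R axis k 1))"
      using smooth_on_imp_differentiable[OF that(1) open_ball that(2)] by (simp only: frechet_derivative_works)
    moreover have "((\<lambda>s. z + s *\<^sub>R axis k 1) has_derivative (\<lambda>d. d *\<^sub>R axis k 1)) (at s)"
      by (auto intro!: derivative_eq_intros)
    ultimately have D: "((\<lambda>s. h (z + s *\<^sub>R axis k 1)) has_derivative
        (\<lambda>d. frechet_derivative h (at (z + s *\<^sub>R axis k 1)) (d *\<^sub>R axis k 1))) (at s)"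
      by (rule has_derivative_compose[rotated])
    have "frechet_derivative h (at (z + s *\<^sub>R axis k 1)) (d *\<^sub>R axis k 1)
        = d * pderiv_at k h (z + s *\<^sub>R axis k 1)" for d
      using linear_frechet_derivative[OF smooth_on_imp_differentiable[OF that(1) open_ball that(2)]]
      by (simp add: linear_cmul pderiv_at_def)
    then show ?thesis using D by (simp add: has_field_derivative_def mult.commute[of _ "pderiv_at _ _ _"])
  qed
  have inb: "x + a *\<^sub>R axis i 1 + b *\<^sub>R axis j 1 \<in> ball x e" if "0 \<le> a" "a \<le> t" "0 \<le> b" "b \<le> t" for a b
  proof -
    have "norm (a *\<^sub>R axis i 1 + b *\<^sub>R axis j (1::real)) \<le> norm (a *\<^sub>R axis i (1::real)) + norm (b *\<^sub>R axis j (1::real))"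
      by (rule norm_triangle_ineq)
    also have "\<dots> = a + b" using that by simp
    also have "\<dots> < e" using that t by simp
    finally show ?thesis by (metis add.assoc dist_0_norm dist_add_cancel dist_commute mem_ball add.right_neutral)
  qed
  have inb0: "x + a *\<^sub>R axis i 1 \<in> ball x e" if "0 \<le> a" "a \<le> t" for a
    using inb[of a 0] that t by simp
  let ?\<phi> = "\<lambda>s. f (x + t *\<^sub>R axis j 1 + s *\<^sub>R axis i 1) - f (x + s *\<^sub>R axis i 1)"
  have "\<exists>\<xi>>0. \<xi> < t \<and> ?\<phi> t - ?\<phi> 0 = (t - 0) * (pderiv_at i f (x + t *\<^sub>R axis j 1 + \<xi> *\<^sub>R axis i 1)
      - pderiv_at i f (x + \<xi> *\<^sub>R axis i 1))"
    using t inb[of _ t] inb0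
    by (intro MVT2 DERIV_diff line f) (auto simp: add_ac)
  then obtain \<xi> where \<xi>: "0 < \<xi>" "\<xi> < t" and e1: "?\<phi> t - ?\<phi> 0 =
      t * (pderiv_at i f (x + t *\<^sub>R axis j 1 + \<xi> *\<^sub>R axis i 1) - pderiv_at i f (x + \<xi> *\<^sub>R axis i 1))"
    by auto
  let ?\<psi> = "\<lambda>s. pderiv_at i f (x + \<xi> *\<^sub>R axis i 1 + s *\<^sub>R axis j 1)"
  have "\<exists>\<eta>>0. \<eta> < t \<and> ?\<psi> t - ?\<psi> 0 = (t - 0) * pderiv_at j (pderiv_at i f) (x + \<xi> *\<^sub>R axis i 1 + \<eta> *\<^sub>R axis j 1)"
    using t inb \<xi> by (intro MVT2 line smooth_on_pderiv f) auto
  then obtain \<eta> where \<eta>: "0 < \<eta>" "\<eta> < t" and e2: "?\<psi> t - ?\<psi> 0 =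
      t * pderiv_at j (pderiv_at i f) (x + \<xi> *\<^sub>R axis i 1 + \<eta> *\<^sub>R axis j 1)"
    by auto
  have "x + t *\<^sub>R axis j 1 + \<xi> *\<^sub>R axis i 1 = x + \<xi> *\<^sub>R axis i 1 + t *\<^sub>R axis j 1"
    "x + t *\<^sub>R axis j 1 + t *\<^sub>R axis i 1 = x + t *\<^sub>R axis i 1 + t *\<^sub>R axis j 1"
    by (simp_all add: add_ac)
  then show ?thesis using e1 e2 \<xi> \<eta> by (intro bexI[of _ \<xi>] bexI[of _ \<eta>]) (auto simp: algebra_simps)
qed

lemma smooth_on_subset: "smooth_on S f \<Longrightarrow> T \<subseteq> S \<Longrightarrow> smooth_on T f"
  unfolding smooth_on_def using differentiable_on_subset by blast

lemma smooth_on_imp_isCont: "smooth_on S f \<Longrightarrow> open S \<Longrightarrow> x \<in> S \<Longrightarrow> isCont f x"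
  using smooth_on_imp_differentiable differentiable_imp_continuous_within by blast

lemma smooth_on_imp_continuous_on: "smooth_on S f \<Longrightarrow> continuous_on S f"
  unfolding smooth_on_def by (metis differentiable_imp_continuous_on iter_pderiv_Nil)

text \<open>The second difference of \<open>f\<close> is symmetric in \<open>i\<close> and
  \<open>j\<close>, so by \<open>second_difference_mvt\<close> the two mixed derivatives share a
  value at points arbitrarily close to \<open>x\<close>; continuity then excludes a gap at
  \<open>x\<close>.\<close>

lemma pderiv_at_commute_real:
  fixes f :: "real^'k::finite \<Rightarrow> real"
  assumes f: "smooth_on S f" and S: "open S" "x \<in> S"
  shows "pderiv_at i (pderiv_at j f) x = pderiv_at j (pderiv_at i f) x"
proof (rule ccontr)
  assume ne: "pderiv_at i (pderiv_at j f) x \<noteq> pderiv_at j (pderiv_at i f) x"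
  \<comment> \<open>Half the gap: values within \<open>d\<close> of the respective mixed derivatives
    at \<open>x\<close> cannot coincide.\<close>
  define d where "d = \<bar>pderiv_at i (pderiv_at j f) x - pderiv_at j (pderiv_at i f) x\<bar> / 2"
  have d: "d > 0" using ne by (simp add: d_def)
  obtain e where e: "e > 0" "ball x e \<subseteq> S" using S openE by blast
  have c: "isCont (pderiv_at i (pderiv_at j f)) x" "isCont (pderiv_at j (pderiv_at i f)) x"
    using f S by (auto intro!: smooth_on_imp_isCont smooth_on_pderiv)
  obtain e1 where e1: "e1 > 0"
    "\<And>y. dist y x < e1 \<Longrightarrow> dist (pderiv_at i (pderiv_at j f) y) (pderiv_at i (pderiv_at j f) x) < d"
    using c(1) d unfolding continuous_at_eps_delta by metis
  obtain e2 where e2: "e2 > 0"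
    "\<And>y. dist y x < e2 \<Longrightarrow> dist (pderiv_at j (pderiv_at i f) y) (pderiv_at j (pderiv_at i f) x) < d"
    using c(2) d unfolding continuous_at_eps_delta by metis
  define t where "t = min e (min e1 e2) / 3"
  have t: "0 < t" "2 * t < e" "2 * t < e1" "2 * t < e2" using e e1 e2 by (auto simp: t_def)
  have f': "smooth_on (ball x e) f" using f e smooth_on_subset by blast
  have near: "dist (x + a *\<^sub>R axis k 1 + b *\<^sub>R axis l 1) x < 2 * t"
    if "a \<in> {0<..<t}" "b \<in> {0<..<t}" for a b and k l :: 'k
  proof -
    have "norm (a *\<^sub>R axis k 1 + b *\<^sub>R axis l (1::real)) \<le> norm (a *\<^sub>R axis k (1::real)) + norm (b *\<^sub>R axis l (1::real))"
      by (rule norm_triangle_ineq)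
    also have "\<dots> = a + b" using that by simp
    also have "\<dots> < 2 * t" using that by simp
    finally show ?thesis by (simp add: dist_norm add.assoc)
  qed
  obtain a b where ab: "a \<in> {0<..<t}" "b \<in> {0<..<t}" and eq1:
    "f (x + t *\<^sub>R axis i 1 + t *\<^sub>R axis j 1) - f (x + t *\<^sub>R axis i 1) - f (x + t *\<^sub>R axis j 1) + f x
    = t * t * pderiv_at j (pderiv_at i f) (x + a *\<^sub>R axis i 1 + b *\<^sub>R axis j 1)"
    using second_difference_mvt[OF f' t(1,2)] by meson
  obtain a' b' where ab': "a' \<in> {0<..<t}" "b' \<in> {0<..<t}" and eq2:
    "f (x + t *\<^sub>R axis j 1 + t *\<^sub>R axis i 1) - f (x + t *\<^sub>R axis j 1) - f (x + t *\<^sub>R axis i 1) + f x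
    = t * t * pderiv_at i (pderiv_at j f) (x + a' *\<^sub>R axis j 1 + b' *\<^sub>R axis i 1)"
    using second_difference_mvt[OF f' t(1,2)] by meson
  have "f (x + t *\<^sub>R axis j 1 + t *\<^sub>R axis i 1) = f (x + t *\<^sub>R axis i 1 + t *\<^sub>R axis j 1)" by (simp add: add_ac)
  then have "t * t * pderiv_at j (pderiv_at i f) (x + a *\<^sub>R axis i 1 + b *\<^sub>R axis j 1)
    = t * t * pderiv_at i (pderiv_at j f) (x + a' *\<^sub>R axis j 1 + b' *\<^sub>R axis i 1)"
    using eq1 eq2 by linarith
  then have "pderiv_at j (pderiv_at i f) (x + a *\<^sub>R axis i 1 + b *\<^sub>R axis j 1)
    = pderiv_at i (pderiv_at j f) (x + a' *\<^sub>R axis j 1 + b' *\<^sub>R axis i 1)"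
    using t by simp
  moreover note e2(2)[OF less_trans[OF near[OF ab, of i j] t(4)]]
    e1(2)[OF less_trans[OF near[OF ab', of j i] t(3)]]
  ultimately show False unfolding d_def dist_real_def by argo
qed

lemma pderiv_at_commute:
  fixes f :: "real^'k::finite \<Rightarrow> real^'m"
  assumes f: "smooth_on S f" and S: "open S" "x \<in> S"
  shows "pderiv_at i (pderiv_at j f) x = pderiv_at j (pderiv_at i f) x"
proof -
  have "pderiv_at k (pderiv_at l f) x $ m = pderiv_at k (pderiv_at l (\<lambda>y. f y $ m)) x" for k l m
  proof -
    have "pderiv_at k (pderiv_at l f) x $ m = pderiv_at k (\<lambda>y. pderiv_at l f y $ m) x"
      by (rule pderiv_at_nth[OF smooth_on_imp_differentiable[OF smooth_on_pderiv[OF f] S], symmetric])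
    also have "\<dots> = pderiv_at k (pderiv_at l (\<lambda>y. f y $ m)) x"
      by (rule pderiv_at_cong[OF S], rule pderiv_at_nth[OF smooth_on_imp_differentiable[OF f S(1)], symmetric])
    finally show ?thesis .
  qed
  then show ?thesis
    using pderiv_at_commute_real[OF smooth_on_nth[OF S(1) f] S] by (simp add: vec_eq_iff)
qed

section \<open>The Poincare lemma on simply connected planar domains\<close>

text \<open>A closed form \<open>P dx + Q dy\<close> is written as \<open>v \<mapsto> Re (c * v)\<close> with \<open>c = P - \<i> Q\<close>; then the
  pullback along a holomorphic \<open>g\<close> is given by \<open>(c \<circ> g) * g'\<close>.\<close>

lemma poincare_lemma_convex:
  fixes c c1 c2 :: "complex \<Rightarrow> complex"
  assumes U: "open U" "convex U" "0 \<in> U"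
    and c: "\<And>z. z \<in> U \<Longrightarrow> (c has_derivative (\<lambda>v. Re v *\<^sub>R c1 z + Im v *\<^sub>R c2 z)) (at z)"
    and cont: "continuous_on U c1" "continuous_on U c2"
    and closed: "\<And>z. z \<in> U \<Longrightarrow> Re (c2 z) = - Im (c1 z)"
  shows "\<exists>f :: complex \<Rightarrow> real. \<forall>z\<in>U. (f has_derivative (\<lambda>v. Re (c z * v))) (at z)"
proof (intro exI ballI)
  \<comment> \<open>The potential is the line integral of the form along the segment from 0 to
    \<open>z\<close>, which convexity keeps in \<open>U\<close>; \<open>D z t\<close> is the
    derivative of its integrand with respect to \<open>z\<close>.\<close>
  define f where "f z = integral {0..1} (\<lambda>t. Re (c (t *\<^sub>R z) * z))" for z
  define c' where "c' z v = Re v *\<^sub>R c1 z + Im v *\<^sub>R c2 z" for z v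
  define D where "D z t v = Re (c' (t *\<^sub>R z) (t *\<^sub>R v) * z + c (t *\<^sub>R z) * v)" for z t v
  have tz: "t *\<^sub>R z \<in> U" if "z \<in> U" "t \<in> {0..1}" for t z
    using convexD[OF U(2) that(1) U(3), of t "1 - t"] that by simp
  have cc: "continuous_on U c"
    using c has_derivative_continuous continuous_at_imp_continuous_on by blast
  have D: "((\<lambda>z. Re (c (t *\<^sub>R z) * z)) has_derivative D z t) (at z)" if "z \<in> U" "t \<in> {0..1}" for z t
  proof -
    have "((\<lambda>z. t *\<^sub>R z) has_derivative (\<lambda>v. t *\<^sub>R v)) (at z)"
      by (auto intro!: derivative_eq_intros)
    from has_derivative_compose[OF this c[OF tz[OF that]]]
    have "((\<lambda>z. c (t *\<^sub>R z)) has_derivative (\<lambda>v. c' (t *\<^sub>R z) (t *\<^sub>R v))) (at z)"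
      by (simp add: c'_def)
    then show ?thesis
      unfolding D_def by (auto intro!: derivative_eq_intros simp: algebra_simps)
  qed
  have cD: "continuous_on (U \<times> {0..1}) (\<lambda>(z, t). D z t v)" for v
    unfolding D_def c'_def split_beta
    by (intro continuous_intros continuous_on_compose2[OF cc] continuous_on_compose2[OF cont(1)]
        continuous_on_compose2[OF cont(2)]) (auto simp: tz)
  fix z assume z: "z \<in> U"
  \<comment> \<open>The Leibniz rule takes the derivative as a \<open>blinfun\<close>; its
    continuity may be checked on basis vectors, the space being finite-dimensional.\<close>
  let ?B = "\<lambda>z t. Blinfun (D z t)"
  have bl: "blinfun_apply (?B w t) = D w t" if "w \<in> U" "t \<in> {0..1}" for w t
    using bounded_linear_Blinfun_apply has_derivative_bounded_linear[OF D[OF that]] by blast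
  have "((\<lambda>w. integral (cbox 0 1) (\<lambda>t. Re (c (t *\<^sub>R w) * w))) has_derivative
      integral (cbox 0 1) (?B z)) (at z within U)"
  proof (rule leibniz_rule)
    show "((\<lambda>w. Re (c (t *\<^sub>R w) * w)) has_derivative ?B w t) (at w within U)"
      if "w \<in> U" "t \<in> cbox 0 1" for w t
      using D that bl has_derivative_at_withinI by (metis cbox_interval)
    show "(\<lambda>t. Re (c (t *\<^sub>R w) * w)) integrable_on cbox 0 1" if "w \<in> U" for w
      by (rule integrable_continuous)
        (auto intro!: continuous_intros continuous_on_compose2[OF cc] simp: tz[OF that])
    show "continuous_on (U \<times> cbox 0 1) (\<lambda>(w, t). ?B w t)"
    proof (rule continuous_on_blinfun_componentwise)
      fix i :: complex
      show "continuous_on (U \<times> cbox 0 1) (\<lambda>x. blinfun_apply (case x of (w, t) \<Rightarrow> ?B w t) i)"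
        by (rule continuous_on_eq[OF cD[of i, folded cbox_interval]]) (auto simp: bl split_beta)
    qed
  qed (use z U in auto)
  then have E: "(f has_derivative integral {0..1} (?B z)) (at z)"
    using at_within_open[OF z U(1)] by (simp add: f_def[abs_def])
  have "blinfun_apply (integral {0..1} (?B z)) v = Re (c z * v)" for v
  proof -
    have cB: "continuous_on {0..1} (?B z)"
    proof (rule continuous_on_blinfun_componentwise)
      fix i :: complex
      have "continuous_on {0..1} (\<lambda>t. (\<lambda>(z, t). D z t i) (z, t))"
        by (rule continuous_on_compose2[OF cD]) (auto intro!: continuous_intros simp: z)
      then show "continuous_on {0..1} (\<lambda>t. blinfun_apply (?B z t) i)"
        by (rule continuous_on_eq) (simp add: bl z)
    qed
    have "blinfun_apply (integral {0..1} (?B z)) v = integral {0..1} (\<lambda>t. blinfun_apply (?B z t) v)"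
      using integral_linear[OF integrable_continuous_real[OF cB] blinfun.bounded_linear_left[of v]]
      by (simp add: o_def)
    also have "\<dots> = integral {0..1} (\<lambda>t. D z t v)"
      by (rule integral_cong) (simp add: bl z)
    \<comment> \<open>The integrand is the derivative in \<open>t\<close> of
      \<open>Re (t *\<^sub>R c (t *\<^sub>R z) * v)\<close>.\<close>
    also have "\<dots> = Re (1 *\<^sub>R c (1 *\<^sub>R z) * v) - Re (0 *\<^sub>R c (0 *\<^sub>R z) * v)"
    proof (rule integral_unique, rule fundamental_theorem_of_calculus)
      fix t :: real assume t: "t \<in> {0..1}"
      have d: "((\<lambda>t. c (t *\<^sub>R z)) has_derivative (\<lambda>d. c' (t *\<^sub>R z) (d *\<^sub>R z))) (at t)"
        unfolding c'_def
        by (rule has_derivative_compose[where f = "\<lambda>t. t *\<^sub>R z" and g = c, OF _ c[OF tz[OF z t]]])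
          (auto intro!: derivative_eq_intros)
      have "((\<lambda>t. Re (t *\<^sub>R c (t *\<^sub>R z) * v)) has_derivative
          (\<lambda>d. Re ((d *\<^sub>R c (t *\<^sub>R z) + t *\<^sub>R c' (t *\<^sub>R z) (d *\<^sub>R z)) * v))) (at t)"
        by (auto intro!: derivative_eq_intros d simp: algebra_simps)
      \<comment> \<open>Closedness says that the bilinear form
        \<open>Re (c' (t *\<^sub>R z) a * b)\<close> is symmetric in \<open>a\<close> and
        \<open>b\<close>, so \<open>z\<close> and \<open>v\<close> may be exchanged.\<close>
      moreover have "Re ((d *\<^sub>R c (t *\<^sub>R z) + t *\<^sub>R c' (t *\<^sub>R z) (d *\<^sub>R z)) * v) = d *\<^sub>R D z t v" for d
        using closed[OF tz[OF z t]] unfolding D_def c'_def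
        by (simp add: algebra_simps)
      ultimately show "((\<lambda>t. Re (t *\<^sub>R c (t *\<^sub>R z) * v)) has_vector_derivative D z t v) (at t within {0..1})"
        unfolding has_vector_derivative_def by (simp add: has_derivative_at_withinI)
    qed simp
    finally show ?thesis by simp
  qed
  then have "blinfun_apply (integral {0..1} (?B z)) = (\<lambda>v. Re (c z * v))" by blast
  with E show "(f has_derivative (\<lambda>v. Re (c z * v))) (at z)" by simp
qed

text \<open>In the case of a disc, the form is pulled back along the inverse Riemann map
  \<open>g\<close>, integrated on the disc, and the potential is carried back along
  \<open>h\<close>. Pullback along a holomorphic map preserves closedness.\<close>

lemma poincare_lemma_complex:
  fixes c c1 c2 :: "complex \<Rightarrow> complex"
  assumes S: "open S" "simply_connected S"
    and c: "\<And>z. z \<in> S \<Longrightarrow> (c has_derivative (\<lambda>v. Re v *\<^sub>R c1 z + Im v *\<^sub>R c2 z)) (at z)"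
    and cont: "continuous_on S c1" "continuous_on S c2"
    and closed: "\<And>z. z \<in> S \<Longrightarrow> Re (c2 z) = - Im (c1 z)"
  shows "\<exists>f :: complex \<Rightarrow> real. \<forall>z\<in>S. (f has_derivative (\<lambda>v. Re (c z * v))) (at z)"
proof -
  consider "S = {}" | "S = UNIV" | f g where "f holomorphic_on S" "g holomorphic_on ball 0 1"
    "\<And>z. z \<in> S \<Longrightarrow> f z \<in> ball 0 1 \<and> g (f z) = z" "\<And>z. z \<in> ball 0 1 \<Longrightarrow> g z \<in> S \<and> f (g z) = z"
    using S by (auto simp: simply_connected_eq_biholomorphic_to_disc)
  then show ?thesis
  proof cases
    case 1
    then show ?thesis by simp
  next
    case 2
    show ?thesis
      by (rule poincare_lemma_convex[of S c c1 c2]) (use assms 2 in auto)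
  next
    case (3 h g)
    let ?B = "ball (0::complex) 1"
    define g1 where "g1 = deriv g"
    define g2 where "g2 = deriv g1"
    have hol: "g1 holomorphic_on ?B" "g2 holomorphic_on ?B"
      unfolding g1_def g2_def using 3(2) by (simp_all add: holomorphic_deriv)
    have dg: "(g has_field_derivative g1 z) (at z)" "(g1 has_field_derivative g2 z) (at z)" if "z \<in> ?B" for z
      unfolding g1_def g2_def
      using holomorphic_derivI[OF 3(2) open_ball that] holomorphic_derivI[OF hol(1) open_ball that]
      by (simp_all add: g1_def)
    have ct: "continuous_on ?B g" "continuous_on ?B g1" "continuous_on ?B g2"
      using hol 3(2) holomorphic_on_imp_continuous_on by auto
    have gS: "g z \<in> S" if "z \<in> ?B" for z using 3(4) that by blast
    have "\<exists>F :: complex \<Rightarrow> real. \<forall>z\<in>?B. (F has_derivative (\<lambda>v. Re ((c (g z) * g1 z) * v))) (at z)"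
    proof (rule poincare_lemma_convex)
      \<comment> \<open>\<open>?c1\<close> and \<open>?c2\<close> are the partial derivatives of
        \<open>c (g z) * g1 z\<close>: to first order a step \<open>v\<close> in the disc becomes
        the step \<open>g1 z * v\<close> in \<open>S\<close>, here with \<open>v\<close> equal to 1
        and to \<i>.\<close>
      let ?c1 = "\<lambda>z. (Re (g1 z) *\<^sub>R c1 (g z) + Im (g1 z) *\<^sub>R c2 (g z)) * g1 z + c (g z) * g2 z"
      let ?c2 = "\<lambda>z. (- Im (g1 z) *\<^sub>R c1 (g z) + Re (g1 z) *\<^sub>R c2 (g z)) * g1 z + \<i> * c (g z) * g2 z"
      have cc: "continuous_on S c"
        using c has_derivative_continuous continuous_at_imp_continuous_on by blast
      show "continuous_on ?B ?c1" "continuous_on ?B ?c2"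
        by (intro continuous_intros ct continuous_on_compose2[OF cc ct(1)] continuous_on_compose2[OF cont(1) ct(1)]
            continuous_on_compose2[OF cont(2) ct(1)]; use gS in blast)+
      fix z assume z: "z \<in> ?B"
      have "((\<lambda>z. c (g z)) has_derivative (\<lambda>v. Re (g1 z * v) *\<^sub>R c1 (g z) + Im (g1 z * v) *\<^sub>R c2 (g z))) (at z)"
        by (rule has_derivative_compose[OF dg(1)[OF z, unfolded has_field_derivative_def] c[OF gS[OF z]]])
      from has_derivative_mult[OF this dg(2)[OF z, unfolded has_field_derivative_def]]
      show "((\<lambda>z. c (g z) * g1 z) has_derivative (\<lambda>v. Re v *\<^sub>R ?c1 z + Im v *\<^sub>R ?c2 z)) (at z)"
        by (rule has_derivative_eq_rhs) (auto simp: fun_eq_iff complex_eq_iff algebra_simps)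
      show "Re (?c2 z) = - Im (?c1 z)"
        using closed[OF gS[OF z]] by (simp add: algebra_simps)
    qed auto
    then obtain F :: "complex \<Rightarrow> real"
      where F: "\<And>z. z \<in> ?B \<Longrightarrow> (F has_derivative (\<lambda>v. Re ((c (g z) * g1 z) * v))) (at z)" by blast
    show ?thesis
    proof (intro exI ballI)
      fix z assume z: "z \<in> S"
      then have hz: "h z \<in> ?B" "g (h z) = z" using 3(3) by auto
      have dh: "(h has_field_derivative deriv h z) (at z)"
        by (rule holomorphic_derivI[OF 3(1) S(1) z])
      \<comment> \<open>Since \<open>g\<close> inverts \<open>h\<close>, the factors
        \<open>g1 (h z)\<close> and \<open>deriv h z\<close> cancel, and pulling back by
        \<open>h\<close> undoes the pullback by \<open>g\<close>.\<close>
      have "((\<lambda>w. g (h w)) has_field_derivative g1 (h z) * deriv h z) (at z)"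
        by (rule DERIV_chain2[OF dg(1)[OF hz(1)] dh])
      moreover have "((\<lambda>w. g (h w)) has_field_derivative 1) (at z)"
        by (rule has_field_derivative_transform_within_open[OF DERIV_ident S(1) z]) (simp add: 3(3))
      ultimately have one: "g1 (h z) * deriv h z = 1" by (rule DERIV_unique)
      have "((\<lambda>w. F (h w)) has_derivative (\<lambda>v. Re ((c (g (h z)) * g1 (h z)) * (deriv h z * v)))) (at z)"
        by (rule has_derivative_compose[OF dh[unfolded has_field_derivative_def] F[OF hz(1)]])
      moreover have "(c (g (h z)) * g1 (h z)) * (deriv h z * v) = c z * v" for v
        using one hz(2) by (metis mult.assoc mult.right_neutral)
      ultimately show "((\<lambda>w. F (h w)) has_derivative (\<lambda>v. Re (c z * v))) (at z)" by simp
    qed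
  qed
qed

section \<open>Transfer of the Poincare lemma from the complex plane to
  \<open>real^2\<close>\<close>

lemma has_derivative_real2:
  assumes "f differentiable at (x :: real^2)"
  shows "(f has_derivative (\<lambda>h. h $ 1 *\<^sub>R pderiv_at 1 f x + h $ 2 *\<^sub>R pderiv_at 2 f x)) (at x)"
  using has_derivative_pderiv[OF assms] by (simp add: UNIV_2)

text \<open>The linear homeomorphisms \<open>k\<close> and \<open>l\<close> identify
  \<open>real^2\<close> with the complex plane and carry over simple connectedness. The potential so
  obtained is smooth because its partial derivatives are the smooth functions \<open>P\<close> and
  \<open>Q\<close>.\<close>

lemma poincare_lemma:
  fixes P Q :: "real^2 \<Rightarrow> real"
  assumes \<Omega>: "open \<Omega>" "simply_connected \<Omega>" and sm: "smooth_on \<Omega> P" "smooth_on \<Omega> Q"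
    and closed: "\<And>x. x \<in> \<Omega> \<Longrightarrow> pderiv_at 2 P x = pderiv_at 1 Q x"
  shows "\<exists>f :: real^2 \<Rightarrow> real. smooth_on \<Omega> f \<and> (\<forall>x\<in>\<Omega>. pderiv_at 1 f x = P x \<and> pderiv_at 2 f x = Q x)"
proof -
  define k :: "real^2 \<Rightarrow> complex" where "k x = Complex (x $ 1) (x $ 2)" for x
  define l :: "complex \<Rightarrow> real^2" where "l z = vector [Re z, Im z]" for z
  have l_nth [simp]: "l z $ 1 = Re z" "l z $ 2 = Im z" for z by (simp_all add: l_def)
  have kl [simp]: "k (l z) = z" "l (k x) = x" for z x
    by (auto simp: k_def vec_eq_iff forall_2 complex_eq_iff)
  have lin: "bounded_linear k" "bounded_linear l"
    by (auto simp: linear_conv_bounded_linear[symmetric] k_def complex_eq_iff vec_eq_iff forall_2 intro!: linearI)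
  have contk: "continuous_on X k" and contl: "continuous_on Y l" for X Y
    using lin linear_continuous_on by blast+
  define S where "S = l -` \<Omega>"
  have "open S" unfolding S_def using \<Omega>(1) contl[of UNIV] by (simp add: open_vimage)
  have "\<Omega> homeomorphic S"
    unfolding homeomorphic_def homeomorphism_def S_def
    using contk contl by (intro exI[of _ k] exI[of _ l]) (auto simp: image_iff, (metis kl)+)
  then have "simply_connected S" using \<Omega>(2) homeomorphic_simply_connected by blast
  have dl: "(l has_derivative l) (at z)" for z using lin(2) by (rule bounded_linear_imp_has_derivative)
  have "\<exists>F :: complex \<Rightarrow> real. \<forall>z\<in>S. (F has_derivative (\<lambda>v. Re (Complex (P (l z)) (- Q (l z)) * v))) (at z)"
  proof (rule poincare_lemma_complex[OF \<open>open S\<close> \<open>simply_connected S\<close>])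
    \<comment> \<open>\<open>?c j\<close> is the derivative of \<open>P - \<i> Q\<close> in
      direction \<open>j\<close>, so closedness in complex form reads
      \<open>pderiv_at 2 P = pderiv_at 1 Q\<close>.\<close>
    let ?c = "\<lambda>j z. of_real (pderiv_at j P (l z)) - \<i> * of_real (pderiv_at j Q (l z))"
    fix z assume "z \<in> S"
    then have lz: "l z \<in> \<Omega>" by (simp add: S_def)
    have dP: "((\<lambda>z. P (l z)) has_derivative
        (\<lambda>h. l h $ 1 *\<^sub>R pderiv_at 1 P (l z) + l h $ 2 *\<^sub>R pderiv_at 2 P (l z))) (at z)"
      by (rule has_derivative_compose[OF dl has_derivative_real2[OF smooth_on_imp_differentiable[OF sm(1) \<Omega>(1) lz]]])
    have dQ: "((\<lambda>z. Q (l z)) has_derivative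
        (\<lambda>h. l h $ 1 *\<^sub>R pderiv_at 1 Q (l z) + l h $ 2 *\<^sub>R pderiv_at 2 Q (l z))) (at z)"
      by (rule has_derivative_compose[OF dl has_derivative_real2[OF smooth_on_imp_differentiable[OF sm(2) \<Omega>(1) lz]]])
    have "((\<lambda>z. of_real (P (l z)) - \<i> * of_real (Q (l z))) has_derivative
       (\<lambda>v. Re v *\<^sub>R ?c 1 z + Im v *\<^sub>R ?c 2 z)) (at z)"
      by (rule derivative_eq_intros dP dQ refl)+ (auto simp: complex_eq_iff)
    moreover have "(\<lambda>z. Complex (P (l z)) (- Q (l z))) = (\<lambda>z. of_real (P (l z)) - \<i> * of_real (Q (l z)))"
      by (auto simp: complex_eq_iff)
    ultimately show "((\<lambda>z. Complex (P (l z)) (- Q (l z))) has_derivative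
       (\<lambda>v. Re v *\<^sub>R ?c 1 z + Im v *\<^sub>R ?c 2 z)) (at z)" by simp
    show "Re (?c 2 z) = - Im (?c 1 z)" using closed[OF lz] by simp
  next
    have "continuous_on S (\<lambda>z. pderiv_at j R (l z))" if "smooth_on \<Omega> R" for j and R :: "real^2 \<Rightarrow> real"
      by (rule continuous_on_compose2[OF smooth_on_imp_continuous_on[OF smooth_on_pderiv[OF that]] contl])
        (auto simp: S_def)
    then show "continuous_on S (\<lambda>z. of_real (pderiv_at 1 P (l z)) - \<i> * of_real (pderiv_at 1 Q (l z)))"
      "continuous_on S (\<lambda>z. of_real (pderiv_at 2 P (l z)) - \<i> * of_real (pderiv_at 2 Q (l z)))"
      by (intro continuous_intros sm; simp add: sm)+
  qed
  then obtain F :: "complex \<Rightarrow> real" where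
    F: "\<And>z. z \<in> S \<Longrightarrow> (F has_derivative (\<lambda>v. Re (Complex (P (l z)) (- Q (l z)) * v))) (at z)" by blast
  have dF: "((\<lambda>x. F (k x)) has_derivative (\<lambda>h. Re (Complex (P x) (- Q x) * k h))) (at x)" if "x \<in> \<Omega>" for x
    using has_derivative_compose[OF bounded_linear_imp_has_derivative[OF lin(1)] F[of "k x"]] that
    by (simp add: S_def)
  have p1: "pderiv_at 1 (\<lambda>x. F (k x)) x = P x" and p2: "pderiv_at 2 (\<lambda>x. F (k x)) x = Q x" if "x \<in> \<Omega>" for x
    by (subst pderiv_at_eq[OF dF[OF that]], simp add: k_def axis_def)+
  have "\<exists>g. smooth_on \<Omega> g \<and> (\<forall>x\<in>\<Omega>. g x = pderiv_at j (\<lambda>x. F (k x)) x)" for j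
    using sm p1 p2 exhaust_2[of j] by metis
  then have "smooth_on \<Omega> (\<lambda>x. F (k x))"
    using dF by (intro smooth_on_pderivI \<Omega>(1)) (auto intro: differentiableI)
  then show ?thesis using p1 p2 by blast
qed

section \<open>Metrics pulled back along a map between equal dimensions\<close>

lemma matrix_inv_inverse:
  assumes "invertible A"
  shows "A ** matrix_inv A = mat 1" "matrix_inv A ** A = mat 1"
  using someI_ex[OF assms[unfolded invertible_def]] by (simp_all add: matrix_inv_def)

lemma matrix_vector_column_sum:
  fixes A :: "real^'n^'m"
  shows "A *v c = (\<Sum>i\<in>UNIV. c $ i *\<^sub>R column i A)"
  by (simp add: vec_eq_iff matrix_vector_mult_def column_def mult.commute)

lemma column_jacobian: "column k (matrix (frechet_derivative u (at x))) = pderiv_at k u x"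
  by (simp add: column_def matrix_def pderiv_at_def vec_eq_iff)

context
  fixes S :: "(real^'k::finite) set" and u :: "real^'k \<Rightarrow> real^'k" and g :: "real^'k \<Rightarrow> real^'k^'k"
  assumes S: "open S" and u: "smooth_on S u"
    and g: "\<And>x. x \<in> S \<Longrightarrow> g x = transpose (matrix (frechet_derivative u (at x))) **
                  matrix (frechet_derivative u (at x))"
    and inv: "\<And>x. x \<in> S \<Longrightarrow> invertible (g x)"
begin

lemma pullback_metric_nth: "x \<in> S \<Longrightarrow> g x $ k $ l = pderiv_at k u x \<bullet> pderiv_at l u x"
  by (simp add: g matrix_matrix_mult_def transpose_def inner_vec_def
      column_jacobian[symmetric] column_def)

lemma invertible_jacobian: "x \<in> S \<Longrightarrow> invertible (matrix (frechet_derivative u (at x)))"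
  using inv[of x] by (auto simp: g invertible_det_nz det_mul)

text \<open>In codimension zero the second derivatives of \<open>u\<close> have no normal part.\<close>

lemma christoffel_pullback:
  assumes x: "x \<in> S"
  shows "(\<Sum>i\<in>UNIV. christoffel g i k l x *\<^sub>R pderiv_at i u x) = pderiv_at k (pderiv_at l u) x"
proof -
  define J where "J = matrix (frechet_derivative u (at x))"
  define w where "w = pderiv_at k (pderiv_at l u) x"
  have dg: "pderiv_at m (\<lambda>y. g y $ a $ b) x
      = pderiv_at m (pderiv_at a u) x \<bullet> pderiv_at b u x + pderiv_at a u x \<bullet> pderiv_at m (pderiv_at b u) x" for m a b
  proof -
    have "pderiv_at m (\<lambda>y. g y $ a $ b) x = pderiv_at m (\<lambda>y. pderiv_at a u y \<bullet> pderiv_at b u y) x"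
      by (rule pderiv_at_cong[OF S x]) (rule pullback_metric_nth)
    also have "\<dots> = pderiv_at m (pderiv_at a u) x \<bullet> pderiv_at b u x + pderiv_at a u x \<bullet> pderiv_at m (pderiv_at b u) x"
      by (rule pderiv_at_bilinear[OF bounded_bilinear_inner])
        (auto intro: smooth_on_imp_differentiable[OF smooth_on_pderiv[OF u] S x])
    finally show ?thesis .
  qed
  have comm: "pderiv_at a (pderiv_at b u) x = pderiv_at b (pderiv_at a u) x" for a b
    by (rule pderiv_at_commute[OF u S x])
  \<comment> \<open>Of the six products that \<open>dg\<close> yields, four cancel by symmetry of
    second derivatives and the other two coincide.\<close>
  have "pderiv_at l (\<lambda>y. g y $ m $ k) x + pderiv_at k (\<lambda>y. g y $ m $ l) x - pderiv_at m (\<lambda>y. g y $ k $ l) x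
      = 2 * (pderiv_at m u x \<bullet> w)" for m
    unfolding dg w_def comm[of l m] comm[of k m] comm[of l k] by (simp add: inner_commute)
  moreover have "(transpose J *v w) $ m = pderiv_at m u x \<bullet> w" for m
    unfolding column_jacobian[symmetric]
    by (simp add: J_def matrix_vector_mul_component transpose_def column_def)
  ultimately have chi: "(\<chi> i. christoffel g i k l x) = matrix_inv (g x) *v (transpose J *v w)"
    by (simp add: vec_eq_iff christoffel_def matrix_vector_mult_def sum_distrib_left mult_ac)
  have "(\<Sum>i\<in>UNIV. christoffel g i k l x *\<^sub>R pderiv_at i u x) = J *v (\<chi> i. christoffel g i k l x)"
    by (simp add: matrix_vector_column_sum J_def column_jacobian)
  also have "\<dots> = J *v (matrix_inv (g x) *v (transpose J *v w))"
    unfolding chi ..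
  also have "\<dots> = (J ** (matrix_inv (g x) ** transpose J)) *v w"
    by (simp only: matrix_vector_mul_assoc matrix_mul_assoc)
  \<comment> \<open>As \<open>g x\<close> is \<open>transpose J ** J\<close>, the matrix
    \<open>matrix_inv (g x) ** transpose J\<close> is a left inverse of \<open>J\<close>. Since
    \<open>J\<close> is square it is also a right inverse; equality of dimensions enters
    here.\<close>
  also have "J ** (matrix_inv (g x) ** transpose J) = mat 1"
  proof -
    have "matrix_inv (g x) ** transpose J ** J = mat 1"
      using matrix_inv_inverse(2)[OF inv[OF x]] g[OF x] by (simp add: J_def matrix_mul_assoc)
    then show ?thesis by (metis matrix_left_right_inverse)
  qed
  finally show ?thesis by (simp add: w_def)
qed

text \<open>By \<open>christoffel_pullback\<close>, \<open>pderiv_at a (e b)\<close> is the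
  combination of the fields \<open>e s\<close> with coefficients \<open>\<Gamma> s a b\<close>.
  After one more differentiation, the coefficients for the two orders differ by the mixed curvature,
  and the \<open>e s\<close> are linearly independent because the Jacobian is invertible.\<close>

lemma riemann_mixed_pullback:
  assumes d: "\<And>i k l x. x \<in> S \<Longrightarrow> christoffel g i k l differentiable at x" and x: "x \<in> S"
  shows "riemann_mixed g s i j k x = 0"
proof -
  define e where "e m = pderiv_at m u" for m
  define \<Gamma> where "\<Gamma> i k l = christoffel g i k l" for i k l
  have e_diff: "e m differentiable at x" for m
    unfolding e_def by (rule smooth_on_imp_differentiable[OF smooth_on_pderiv[OF u] S x])
  have \<Gamma>_diff: "\<Gamma> a b c differentiable at x" for a b c
    unfolding \<Gamma>_def by (rule d[OF x])
  have ch: "pderiv_at a (e b) x = (\<Sum>s\<in>UNIV. \<Gamma> s a b x *\<^sub>R e s x)" for a b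
    by (simp add: christoffel_pullback x \<Gamma>_def e_def)
  have third: "pderiv_at b (pderiv_at a (e c)) x
      = (\<Sum>s\<in>UNIV. (pderiv_at b (\<Gamma> s a c) x + (\<Sum>m\<in>UNIV. \<Gamma> s b m x * \<Gamma> m a c x)) *\<^sub>R e s x)" for a b c
  proof -
    have "pderiv_at b (pderiv_at a (e c)) x = pderiv_at b (\<lambda>y. \<Sum>m\<in>UNIV. \<Gamma> m a c y *\<^sub>R e m y) x"
      by (rule pderiv_at_cong[OF S x]) (simp add: christoffel_pullback \<Gamma>_def e_def)
    also have "\<dots> = (\<Sum>m\<in>UNIV. pderiv_at b (\<lambda>y. \<Gamma> m a c y *\<^sub>R e m y) x)"
      by (rule pderiv_at_sum) (use \<Gamma>_diff e_diff in simp)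
    also have "\<dots> = (\<Sum>m\<in>UNIV. pderiv_at b (\<Gamma> m a c) x *\<^sub>R e m x + \<Gamma> m a c x *\<^sub>R pderiv_at b (e m) x)"
      by (rule sum.cong[OF refl], rule pderiv_at_bilinear[OF bounded_bilinear_scaleR \<Gamma>_diff e_diff])
    also have "\<dots> = (\<Sum>m\<in>UNIV. pderiv_at b (\<Gamma> m a c) x *\<^sub>R e m x)
        + (\<Sum>m\<in>UNIV. \<Sum>s\<in>UNIV. (\<Gamma> s b m x * \<Gamma> m a c x) *\<^sub>R e s x)"
      by (simp add: ch sum.distrib scaleR_sum_right mult.commute)
    also have "(\<Sum>m\<in>UNIV. \<Sum>s\<in>UNIV. (\<Gamma> s b m x * \<Gamma> m a c x) *\<^sub>R e s x)
        = (\<Sum>s\<in>UNIV. (\<Sum>m\<in>UNIV. \<Gamma> s b m x * \<Gamma> m a c x) *\<^sub>R e s x)"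
      by (subst sum.swap) (simp add: scaleR_sum_left)
    finally show ?thesis by (simp add: sum.distrib scaleR_left_distrib)
  qed
  have c2: "pderiv_at a (e b) y = pderiv_at b (e a) y" if "y \<in> S" for a b y
    unfolding e_def by (rule pderiv_at_commute[OF u S that])
  \<comment> \<open>The detour through \<open>e i\<close> leads to the symbols
    \<open>\<Gamma> s i k\<close> and \<open>\<Gamma> s i j\<close> in exactly the index order of
    \<open>riemann_mixed\<close>.\<close>
  have "pderiv_at j (pderiv_at i (e k)) x = pderiv_at j (pderiv_at k (e i)) x"
    by (rule pderiv_at_cong[OF S x c2])
  also have "\<dots> = pderiv_at k (pderiv_at j (e i)) x"
    unfolding e_def by (rule pderiv_at_commute[OF smooth_on_pderiv[OF u] S x])
  also have "\<dots> = pderiv_at k (pderiv_at i (e j)) x"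
    by (rule pderiv_at_cong[OF S x c2])
  finally have eq: "pderiv_at j (pderiv_at i (e k)) x - pderiv_at k (pderiv_at i (e j)) x = 0" by simp
  have "0 = (\<Sum>s\<in>UNIV. riemann_mixed g s i j k x *\<^sub>R e s x)"
    unfolding riemann_mixed_def \<Gamma>_def[symmetric] eq[symmetric] third
    by (simp add: algebra_simps sum.distrib sum_subtractf)
  then have "matrix (frechet_derivative u (at x)) *v (\<chi> s. riemann_mixed g s i j k x) = 0"
    by (simp add: matrix_vector_column_sum column_jacobian e_def)
  then have "(\<chi> s. riemann_mixed g s i j k x) = 0"
    using invertible_jacobian[OF x] by (metis invertible_left_inverse matrix_left_invertible_ker)
  then show ?thesis by (simp add: vec_eq_iff)
qed

end

section \<open>Lowered Christoffel symbols and the component R1212\<close>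

text \<open>Christoffel symbols of the first kind. They are free of \<open>matrix_inv\<close>, so
  their derivatives are linear in the second derivatives of the metric.\<close>

definition christoffel_lower :: "(real^'k::finite \<Rightarrow> real^'k^'k) \<Rightarrow> 'k \<Rightarrow> 'k \<Rightarrow> 'k \<Rightarrow> real^'k \<Rightarrow> real" where
  "christoffel_lower g m k l x = 1/2 * (pderiv_at l (\<lambda>y. g y $ m $ k) x + pderiv_at k (\<lambda>y. g y $ m $ l) x
        - pderiv_at m (\<lambda>y. g y $ k $ l) x)"

lemma christoffel_eq_lower:
  "christoffel g i k l x = (\<Sum>m\<in>UNIV. matrix_inv (g x) $ i $ m * christoffel_lower g m k l x)"
  by (simp add: christoffel_def christoffel_lower_def sum_distrib_left)

lemma lower_christoffel:
  assumes "invertible (g x)"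
  shows "(\<Sum>m\<in>UNIV. g x $ s $ m * christoffel g m k l x) = christoffel_lower g s k l x"
proof -
  have "(\<chi> m. christoffel g m k l x) = matrix_inv (g x) *v (\<chi> m. christoffel_lower g m k l x)"
    by (simp add: vec_eq_iff christoffel_eq_lower matrix_vector_mult_def)
  then have "g x *v (\<chi> m. christoffel g m k l x) = (\<chi> m. christoffel_lower g m k l x)"
    by (simp add: matrix_vector_mul_assoc matrix_inv_inverse[OF assms])
  then show ?thesis by (simp add: vec_eq_iff matrix_vector_mult_def)
qed

lemma christoffel_lower_commute:
  assumes "open S" "x \<in> S" "\<And>y. y \<in> S \<Longrightarrow> transpose (g y) = g y"
  shows "christoffel_lower g m k l x = christoffel_lower g m l k x"
proof -
  have "g y $ a $ b = g y $ b $ a" if "y \<in> S" for y a b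
    using assms(3)[OF that] by (simp add: vec_eq_iff transpose_def)
  then have "pderiv_at m (\<lambda>y. g y $ k $ l) x = pderiv_at m (\<lambda>y. g y $ l $ k) x"
    by (rule pderiv_at_cong[OF assms(1,2)])
  then show ?thesis by (simp add: christoffel_lower_def)
qed

text \<open>Moving \<open>g\<close> inside the derivative of a Christoffel symbol costs a term with
  the derivative of \<open>g\<close>, which splits into two lowered symbols. One cancels the
  quadratic term of the mixed curvature, the other survives with the opposite sign.\<close>

lemma riemann_lower:
  fixes g :: "real^'k::finite \<Rightarrow> real^'k^'k"
  assumes S: "open S" "x \<in> S"
    and sym: "\<And>y. y \<in> S \<Longrightarrow> transpose (g y) = g y"
    and inv: "\<And>y. y \<in> S \<Longrightarrow> invertible (g y)"
    and sm: "\<And>a b. smooth_on S (\<lambda>y. g y $ a $ b)"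
    and \<Gamma>: "\<And>a b c. smooth_on S (christoffel g a b c)"
  shows "riemann g s i j k x = pderiv_at j (christoffel_lower g s i k) x - pderiv_at k (christoffel_lower g s i j) x
    - (\<Sum>m\<in>UNIV. christoffel_lower g m s j x * christoffel g m i k x)
    + (\<Sum>m\<in>UNIV. christoffel_lower g m s k x * christoffel g m i j x)"
proof -
  have gs: "g y $ a $ b = g y $ b $ a" if "y \<in> S" for y a b
    using sym[OF that] by (simp add: vec_eq_iff transpose_def)
  have ps: "pderiv_at c (\<lambda>y. g y $ a $ b) x = pderiv_at c (\<lambda>y. g y $ b $ a) x" for a b c
    by (rule pderiv_at_cong[OF S gs])
  note dg = smooth_on_imp_differentiable[OF sm S]
  note d\<Gamma> = smooth_on_imp_differentiable[OF \<Gamma> S]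
  have main: "(\<Sum>m\<in>UNIV. g x $ s $ m * (pderiv_at b (christoffel g m a c) x
        + (\<Sum>l\<in>UNIV. christoffel g m b l x * christoffel g l a c x)))
      = pderiv_at b (christoffel_lower g s a c) x
        - (\<Sum>m\<in>UNIV. christoffel_lower g m s b x * christoffel g m a c x)" for a b c
  proof -
    have "pderiv_at b (christoffel_lower g s a c) x
        = pderiv_at b (\<lambda>y. \<Sum>m\<in>UNIV. g y $ s $ m * christoffel g m a c y) x"
      by (rule pderiv_at_cong[OF S]) (simp add: lower_christoffel inv)
    also have "\<dots> = (\<Sum>m\<in>UNIV. pderiv_at b (\<lambda>y. g y $ s $ m * christoffel g m a c y) x)"
      by (rule pderiv_at_sum) (simp add: dg d\<Gamma>)
    also have "\<dots> = (\<Sum>m\<in>UNIV. pderiv_at b (\<lambda>y. g y $ s $ m) x * christoffel g m a c x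
        + g x $ s $ m * pderiv_at b (christoffel g m a c) x)"
      by (rule sum.cong[OF refl]) (simp add: pderiv_at_mult dg d\<Gamma>)
    finally have 1: "pderiv_at b (christoffel_lower g s a c) x
      = (\<Sum>m\<in>UNIV. pderiv_at b (\<lambda>y. g y $ s $ m) x * christoffel g m a c x)
        + (\<Sum>m\<in>UNIV. g x $ s $ m * pderiv_at b (christoffel g m a c) x)"
      by (simp add: sum.distrib)
    \<comment> \<open>Compatibility of the Levi-Civita connection with the metric.\<close>
    have "pderiv_at b (\<lambda>y. g y $ s $ m) x = christoffel_lower g s b m x + christoffel_lower g m s b x" for m
      unfolding christoffel_lower_def ps[of _ m s] ps[of _ b s] ps[of _ b m] by (simp add: field_simps)
    then have 2: "(\<Sum>m\<in>UNIV. pderiv_at b (\<lambda>y. g y $ s $ m) x * christoffel g m a c x)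
      = (\<Sum>m\<in>UNIV. christoffel_lower g s b m x * christoffel g m a c x)
        + (\<Sum>m\<in>UNIV. christoffel_lower g m s b x * christoffel g m a c x)"
      by (simp add: sum.distrib algebra_simps)
    have 3: "(\<Sum>m\<in>UNIV. g x $ s $ m * (\<Sum>l\<in>UNIV. christoffel g m b l x * christoffel g l a c x))
      = (\<Sum>l\<in>UNIV. christoffel_lower g s b l x * christoffel g l a c x)"
      unfolding lower_christoffel[where g = g and x = x, OF inv[OF S(2)], symmetric] sum_distrib_left sum_distrib_right
      by (subst sum.swap) (simp add: mult.assoc)
    show ?thesis using 1 2 3 by (simp add: distrib_left sum.distrib)
  qed
  have "riemann g s i j k x = (\<Sum>m\<in>UNIV. g x $ s $ m * (pderiv_at j (christoffel g m i k) x
        + (\<Sum>l\<in>UNIV. christoffel g m j l x * christoffel g l i k x)))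
     - (\<Sum>m\<in>UNIV. g x $ s $ m * (pderiv_at k (christoffel g m i j) x
        + (\<Sum>l\<in>UNIV. christoffel g m k l x * christoffel g l i j x)))"
    unfolding riemann_def riemann_mixed_def sum_subtractf[symmetric]
    by (rule sum.cong[OF refl]) (simp add: algebra_simps)
  then show ?thesis unfolding main by simp
qed

text \<open>The derivatives of the lowered symbols in \<open>riemann_lower\<close> add up to the
  linearised curvature \<open>- curlT_curl g / 2\<close>, by symmetry of \<open>g\<close>; the
  remainder is quadratic in the Christoffel symbols.\<close>

lemma riemann_1212:
  fixes g :: "real^2 \<Rightarrow> real^2^2"
  assumes S: "open S" "x \<in> S"
    and sym: "\<And>y. y \<in> S \<Longrightarrow> transpose (g y) = g y"
    and inv: "\<And>y. y \<in> S \<Longrightarrow> invertible (g y)"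
    and sm: "\<And>a b. smooth_on S (\<lambda>y. g y $ a $ b)"
    and \<Gamma>: "\<And>a b c. smooth_on S (christoffel g a b c)"
  shows "riemann g 1 2 1 2 x = - curlT_curl g x / 2
    - (\<Sum>m\<in>UNIV. christoffel_lower g m 1 1 x * christoffel g m 2 2 x)
    + (\<Sum>m\<in>UNIV. christoffel_lower g m 1 2 x * christoffel g m 1 2 x)"
proof -
  have gs: "g y $ 2 $ 1 = g y $ 1 $ 2" if "y \<in> S" for y
    using sym[OF that] by (simp add: vec_eq_iff transpose_def)
  have "christoffel_lower g m 2 1 x = christoffel_lower g m 1 2 x" for m
    by (rule christoffel_lower_commute[OF S sym])
  then have c: "christoffel g m 2 1 x = christoffel g m 1 2 x" for m
    by (simp add: christoffel_eq_lower)
  note d = smooth_on_imp_differentiable[OF smooth_on_pderiv[OF sm] S]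
  have "pderiv_at 1 (christoffel_lower g 1 2 2) x
      = pderiv_at 1 (\<lambda>y. pderiv_at 2 (\<lambda>y. g y $ 1 $ 2) y - 1/2 * pderiv_at 1 (\<lambda>y. g y $ 2 $ 2) y) x"
    by (simp add: christoffel_lower_def[abs_def] diff_divide_distrib)
  also have "\<dots> = pderiv_at 1 (pderiv_at 2 (\<lambda>y. g y $ 1 $ 2)) x - 1/2 * pderiv_at 1 (pderiv_at 1 (\<lambda>y. g y $ 2 $ 2)) x"
    by (simp add: pderiv_at_diff pderiv_at_divide d)
  finally have 1: "pderiv_at 1 (christoffel_lower g 1 2 2) x = \<dots>" .
  have "pderiv_at 2 (christoffel_lower g 1 2 1) x = pderiv_at 2 (\<lambda>y. 1/2 * pderiv_at 2 (\<lambda>y. g y $ 1 $ 1) y) x"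
  proof (rule pderiv_at_cong[OF S])
    fix y assume "y \<in> S"
    then have "pderiv_at 1 (\<lambda>y. g y $ 2 $ 1) y = pderiv_at 1 (\<lambda>y. g y $ 1 $ 2) y"
      by (intro pderiv_at_cong[OF S(1)] gs)
    then show "christoffel_lower g 1 2 1 y = 1/2 * pderiv_at 2 (\<lambda>y. g y $ 1 $ 1) y"
      by (simp add: christoffel_lower_def)
  qed
  also have "\<dots> = 1/2 * pderiv_at 2 (pderiv_at 2 (\<lambda>y. g y $ 1 $ 1)) x"
    by (simp add: pderiv_at_divide d)
  finally have 2: "pderiv_at 2 (christoffel_lower g 1 2 1) x = \<dots>" .
  have "riemann g 1 2 1 2 x = pderiv_at 1 (christoffel_lower g 1 2 2) x - pderiv_at 2 (christoffel_lower g 1 2 1) x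
    - (\<Sum>m\<in>UNIV. christoffel_lower g m 1 1 x * christoffel g m 2 2 x)
    + (\<Sum>m\<in>UNIV. christoffel_lower g m 1 2 x * christoffel g m 2 1 x)"
    by (rule riemann_lower[OF S]) (use sym inv sm \<Gamma> in auto)
  then show ?thesis unfolding 1 2 c curlT_curl_def by simp
qed

section \<open>Rank-one updates of the identity and their inverses\<close>

lemma tensor_nth [simp]: "(v \<otimes> w) $ i $ j = v $ i * w $ j"
  by (simp add: tensor_def)

lemma tensor_mult_vector: "(v \<otimes> w) *v z = (w \<bullet> z) *\<^sub>R v"
  by (simp add: vec_eq_iff matrix_vector_mult_def inner_vec_def sum_distrib_left mult_ac)

text \<open>For a unit vector \<open>v\<close> the matrix \<open>v \<otimes> v\<close> projects onto
  the line of \<open>v\<close>. The first factor scales this line by \<open>c * \<rho>\<close> and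
  its orthogonal complement by \<open>c\<close>, the second factor by the reciprocals.\<close>

lemma rank_one_update_mult:
  fixes v :: "real^'n"
  assumes v: "norm v = 1" and c: "c \<noteq> 0" and \<rho>: "\<rho> \<noteq> 0"
  shows "(c *\<^sub>R (mat 1 + (\<rho> - 1) *\<^sub>R (v \<otimes> v))) ** ((1/c) *\<^sub>R (mat 1 + (1/\<rho> - 1) *\<^sub>R (v \<otimes> v))) = mat 1"
    (is "?A ** ?B = _")
proof -
  have vv: "v \<bullet> v = 1" using v by (simp add: dot_square_norm)
  have ap: "(d *\<^sub>R (mat 1 + k *\<^sub>R (v \<otimes> v))) *v w = d *\<^sub>R w + (d * k * (v \<bullet> w)) *\<^sub>R v" for d k w
    by (simp add: scaleR_matrix_vector_assoc[symmetric] matrix_vector_mult_add_rdistrib tensor_mult_vector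
        scaleR_right_distrib)
  have "(?A ** ?B) *v w = w" for w
  proof -
    have "(?A ** ?B) *v w = ?A *v (?B *v w)" by (simp only: matrix_vector_mul_assoc)
    also have "\<dots> = w + (((1/\<rho> - 1) + (\<rho> - 1) * (1 + (1/\<rho> - 1))) * (v \<bullet> w)) *\<^sub>R v"
    proof -
      have "c * (\<rho> - 1) * (v \<bullet> ((1/c) *\<^sub>R w + ((1/c) * (1/\<rho> - 1) * (v \<bullet> w)) *\<^sub>R v))
          = (\<rho> - 1) * (1 + (1/\<rho> - 1)) * (v \<bullet> w)"
        using c \<rho> by (simp add: inner_right_distrib vv field_simps)
      then show ?thesis
        unfolding ap using c by (simp add: scaleR_add_right algebra_simps flip: scaleR_add_left)
    qed
    also have "(1/\<rho> - 1) + (\<rho> - 1) * (1 + (1/\<rho> - 1)) = 0" using \<rho> by (simp add: field_simps)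
    finally show ?thesis by simp
  qed
  then show ?thesis by (simp add: matrix_eq)
qed

lemma invertible_rank_one_update:
  fixes v :: "real^'n"
  assumes "norm v = 1" "c \<noteq> 0" "\<rho> \<noteq> 0"
  shows "invertible (c *\<^sub>R (mat 1 + (\<rho> - 1) *\<^sub>R (v \<otimes> v)))"
  using rank_one_update_mult[OF assms] invertible_right_inverse by blast

lemma matrix_inv_rank_one_update:
  fixes v :: "real^'n"
  assumes "norm v = 1" "c \<noteq> 0" "\<rho> \<noteq> 0"
  shows "matrix_inv (c *\<^sub>R (mat 1 + (\<rho> - 1) *\<^sub>R (v \<otimes> v))) = (1/c) *\<^sub>R (mat 1 + (1/\<rho> - 1) *\<^sub>R (v \<otimes> v))"
  (is "matrix_inv ?A = ?B")
proof -
  have "?B = matrix_inv ?A ** ?A ** ?B"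
    by (simp only: matrix_inv_inverse(2)[OF invertible_rank_one_update[OF assms]] matrix_mul_lid)
  also have "\<dots> = matrix_inv ?A"
    by (simp only: matrix_mul_assoc[symmetric] rank_one_update_mult[OF assms] matrix_mul_rid)
  finally show ?thesis ..
qed

section \<open>Metrics built from a planar director\<close>

lemma principal_block_nth [simp]:
  "principal_block A $ 1 $ 1 = A $ 1 $ 1" "principal_block A $ 1 $ 2 = A $ 1 $ 2"
  "principal_block A $ 2 $ 1 = A $ 2 $ 1" "principal_block A $ 2 $ 2 = A $ 2 $ 2"
  by (simp_all add: principal_block_def)

locale planar_director =
  fixes \<Omega> :: "(real^2) set" and n :: "real^2 \<Rightarrow> real^2" and r :: real
  assumes open_\<Omega>: "open \<Omega>" and smooth_n: "smooth_on \<Omega> n"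
    and norm_n: "x \<in> \<Omega> \<Longrightarrow> norm (n x) = 1" and r_pos: "r > 0"
begin

definition p where "p x = n x $ 1"
definition q where "q x = n x $ 2"

text \<open>The gradient of the angle of \<open>n\<close>; the angle itself is never needed.\<close>

definition t where "t j x = p x * pderiv_at j q x - q x * pderiv_at j p x"

definition g where "g y = mat 1 + (r^2 - 1) *\<^sub>R (n y \<otimes> n y)"

lemma n_nth [simp]: "n x $ 1 = p x" "n x $ 2 = q x"
  by (simp_all add: p_def q_def)

lemma g_nth [simp]: "g y $ 1 $ 1 = 1 + (r^2 - 1) * p y ^ 2" "g y $ 1 $ 2 = (r^2 - 1) * (p y * q y)"
  "g y $ 2 $ 1 = (r^2 - 1) * (p y * q y)" "g y $ 2 $ 2 = 1 + (r^2 - 1) * q y ^ 2"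
  by (simp_all add: g_def mat_def power2_eq_square)

lemma smooth_pq: "smooth_on \<Omega> p" "smooth_on \<Omega> q"
  unfolding p_def[abs_def] q_def[abs_def] by (rule smooth_on_nth[OF open_\<Omega> smooth_n])+

lemma smooth_t: "smooth_on \<Omega> (t j)"
  unfolding t_def[abs_def] by (intro smooth_on_intros open_\<Omega> smooth_pq)

lemma differentiable [simp]:
  assumes "x \<in> \<Omega>"
  shows "p differentiable at x" "q differentiable at x" "t j differentiable at x"
  by (rule smooth_on_imp_differentiable[OF _ open_\<Omega> assms], rule smooth_pq smooth_t)+

lemma pq_unit:
  assumes "x \<in> \<Omega>"
  shows "p x ^ 2 + q x ^ 2 = 1"
proof -
  have "n x \<bullet> n x = 1" using norm_n[OF assms] by (simp add: dot_square_norm)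
  then show ?thesis by (simp add: inner_vec_def sum_2 power2_eq_square)
qed

text \<open>Differentiating the unit length condition shows that each derivative of \<open>n\<close>
  is \<open>t j\<close> times \<open>n\<close> turned by a right angle. As simp rules these
  equations express all derivatives of \<open>n\<close> through \<open>p\<close>, \<open>q\<close>
  and \<open>t\<close>.\<close>

lemma pderiv_pq [simp]:
  assumes x: "x \<in> \<Omega>"
  shows "pderiv_at j p x = - q x * t j x" "pderiv_at j q x = p x * t j x"
proof -
  have "pderiv_at j (\<lambda>y. p y * p y + q y * q y) x = pderiv_at j (\<lambda>y. 1) x"
    by (rule pderiv_at_cong[OF open_\<Omega> x]) (use pq_unit in \<open>simp add: power2_eq_square\<close>)
  then have "p x * pderiv_at j p x + q x * pderiv_at j q x = 0"
    using x by (simp add: pderiv_at_add pderiv_at_mult)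
  then show "pderiv_at j p x = - q x * t j x" "pderiv_at j q x = p x * t j x"
    using pq_unit[OF x] unfolding t_def by algebra+
qed

text \<open>The mixed second derivatives of \<open>p\<close> and \<open>q\<close> match by symmetry.
  The products of first derivatives match because by \<open>pderiv_pq\<close> the gradients of
  \<open>p\<close> and \<open>q\<close> are both multiples of \<open>t\<close>.\<close>

lemma pderiv_t_commute:
  assumes x: "x \<in> \<Omega>"
  shows "pderiv_at 2 (t 1) x = pderiv_at 1 (t 2) x"
proof -
  have d: "pderiv_at j p differentiable at x" "pderiv_at j q differentiable at x" for j
    using smooth_on_imp_differentiable[OF smooth_on_pderiv open_\<Omega> x] smooth_pq by auto
  have "pderiv_at 2 (pderiv_at 1 p) x = pderiv_at 1 (pderiv_at 2 p) x"
    "pderiv_at 2 (pderiv_at 1 q) x = pderiv_at 1 (pderiv_at 2 q) x"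
    by (rule pderiv_at_commute_real[OF _ open_\<Omega> x], rule smooth_pq)+
  then show ?thesis
    unfolding t_def[abs_def] using x d
    by (simp add: pderiv_at_diff pderiv_at_mult algebra_simps)
qed

lemma transpose_g: "transpose (g y) = g y"
  by (simp add: vec_eq_iff forall_2 transpose_def)

text \<open>The factor 1 brings \<open>g\<close> into the shape of the rank-one update
  lemmas.\<close>

lemma g_scaleR: "g y = 1 *\<^sub>R (mat 1 + (r^2 - 1) *\<^sub>R (n y \<otimes> n y))"
  by (simp add: g_def)

lemma invertible_g: "y \<in> \<Omega> \<Longrightarrow> invertible (g y)"
  unfolding g_scaleR using invertible_rank_one_update[OF norm_n, of y 1 "r^2"] r_pos by simp

lemma matrix_inv_g: "y \<in> \<Omega> \<Longrightarrow> matrix_inv (g y) = mat 1 + (1 / r^2 - 1) *\<^sub>R (n y \<otimes> n y)"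
  unfolding g_scaleR using matrix_inv_rank_one_update[OF norm_n, of y 1 "r^2"] r_pos by simp

lemma det_g: "y \<in> \<Omega> \<Longrightarrow> det (g y) \<noteq> 0"
  using invertible_g invertible_det_nz by blast

lemma smooth_n_nth: "smooth_on \<Omega> (\<lambda>y. n y $ i)"
  by (rule smooth_on_nth[OF open_\<Omega> smooth_n])

lemma smooth_g: "smooth_on \<Omega> (\<lambda>y. g y $ a $ b)"
  unfolding g_def by (simp add: smooth_on_intros open_\<Omega> smooth_n_nth)

text \<open>The closed form of \<open>matrix_inv\<close>, polynomial in \<open>n\<close>, makes it
  unnecessary to differentiate matrix inversion.\<close>

lemma smooth_christoffel: "smooth_on \<Omega> (christoffel g i k l)"
proof (rule smooth_on_cong[OF open_\<Omega>])
  show "smooth_on \<Omega> (\<lambda>x. 1/2 * (\<Sum>m\<in>UNIV. (mat 1 $ i $ m + (1 / r^2 - 1) * (n x $ i * n x $ m)) *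
     (pderiv_at l (\<lambda>y. g y $ m $ k) x + pderiv_at k (\<lambda>y. g y $ m $ l) x
        - pderiv_at m (\<lambda>y. g y $ k $ l) x)))"
    by (intro smooth_on_intros open_\<Omega> smooth_n_nth smooth_g)
qed (simp add: christoffel_def matrix_inv_g)

lemma pderiv_g:
  assumes "x \<in> \<Omega>"
  shows "pderiv_at j (\<lambda>y. g y $ 1 $ 1) x = (r^2 - 1) * (- 2 * p x * q x * t j x)"
    "pderiv_at j (\<lambda>y. g y $ 1 $ 2) x = (r^2 - 1) * ((p x ^ 2 - q x ^ 2) * t j x)"
    "pderiv_at j (\<lambda>y. g y $ 2 $ 1) x = (r^2 - 1) * ((p x ^ 2 - q x ^ 2) * t j x)"
    "pderiv_at j (\<lambda>y. g y $ 2 $ 2) x = (r^2 - 1) * (2 * p x * q x * t j x)"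
  unfolding g_nth using assms
  by (simp add: power2_eq_square pderiv_at_add pderiv_at_mult; simp add: algebra_simps)+

text \<open>For these metrics the quadratic terms of \<open>R\<^sub>1\<^sub>2\<^sub>1\<^sub>2\<close> cancel.\<close>

lemma riemann_g:
  assumes x: "x \<in> \<Omega>"
  shows "riemann g 1 2 1 2 x = - curlT_curl g x / 2"
proof -
  define k where "k = r^2 - 1"
  have L: "christoffel_lower g 1 1 1 x = - k * (p x * q x * t 1 x)"
    "christoffel_lower g 2 1 1 x = k * ((p x ^ 2 - q x ^ 2) * t 1 x + p x * q x * t 2 x)"
    "christoffel_lower g 1 1 2 x = - k * (p x * q x * t 2 x)"
    "christoffel_lower g 2 1 2 x = k * (p x * q x * t 1 x)"
    "christoffel_lower g 1 2 2 x = k * ((p x ^ 2 - q x ^ 2) * t 2 x - p x * q x * t 1 x)"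
    "christoffel_lower g 2 2 2 x = k * (p x * q x * t 2 x)"
    unfolding christoffel_lower_def k_def pderiv_g[OF x] by (simp_all add: field_simps)
  define m where "m = 1 / r^2 - 1"
  have i: "matrix_inv (g x) $ 1 $ 1 = 1 + m * p x ^ 2" "matrix_inv (g x) $ 1 $ 2 = m * (p x * q x)"
    "matrix_inv (g x) $ 2 $ 1 = m * (p x * q x)" "matrix_inv (g x) $ 2 $ 2 = 1 + m * q x ^ 2"
    by (simp_all add: matrix_inv_g[OF x] m_def mat_def power2_eq_square)
  \<comment> \<open>The inverse metric is the identity plus \<open>m\<close> times
    \<open>n \<otimes> n\<close>. On both sides the identity contributes
    \<open>k^2 p^2 q^2 (t1^2 + t2^2)\<close> and the other part
    \<open>m k^2 p^2 q^2 (p t2 - q t1)^2\<close>.\<close>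
  have "(\<Sum>m\<in>UNIV. christoffel_lower g m 1 1 x * christoffel g m 2 2 x)
      = (\<Sum>m\<in>UNIV. christoffel_lower g m 1 2 x * christoffel g m 1 2 x)"
    unfolding sum_2 christoffel_eq_lower L i by (simp add: algebra_simps power2_eq_square)
  then show ?thesis
    using riemann_1212[OF open_\<Omega> x transpose_g invertible_g smooth_g smooth_christoffel] by simp
qed

lemma gauss_curvature_zero_iff:
  assumes "x \<in> \<Omega>"
  shows "gauss_curvature g x = 0 \<longleftrightarrow> curlT_curl g x = 0"
  using det_g[OF assms] by (simp add: gauss_curvature_def riemann_g[OF assms])

lemma curlT_curl_g:
  assumes x: "x \<in> \<Omega>"
  shows "curlT_curl g x = (r^2 - 1) *
    (pderiv_at 2 (\<lambda>y. - 2 * p y * q y * t 2 y) x - 2 * pderiv_at 1 (\<lambda>y. (p y ^ 2 - q y ^ 2) * t 2 y) x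
      + pderiv_at 1 (\<lambda>y. 2 * p y * q y * t 1 y) x)"
proof -
  have "pderiv_at k (pderiv_at j (\<lambda>y. g y $ a $ b)) x = (r^2 - 1) * pderiv_at k f x"
    if "\<And>y. y \<in> \<Omega> \<Longrightarrow> pderiv_at j (\<lambda>y. g y $ a $ b) y = (r^2 - 1) * f y" "f differentiable at x" for a b j k f
    using pderiv_at_cong[where f = "pderiv_at j (\<lambda>y. g y $ a $ b)", OF open_\<Omega> x that(1)] that(2)
    by (simp add: pderiv_at_mult)
  note second = this
  have 11: "pderiv_at 2 (pderiv_at 2 (\<lambda>y. g y $ 1 $ 1)) x = (r^2 - 1) * pderiv_at 2 (\<lambda>y. - 2 * p y * q y * t 2 y) x"
    by (rule second, erule pderiv_g(1)) (simp add: x)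
  have 12: "pderiv_at 1 (pderiv_at 2 (\<lambda>y. g y $ 1 $ 2)) x = (r^2 - 1) * pderiv_at 1 (\<lambda>y. (p y ^ 2 - q y ^ 2) * t 2 y) x"
    by (rule second, erule pderiv_g(2)) (simp add: x)
  have 22: "pderiv_at 1 (pderiv_at 1 (\<lambda>y. g y $ 2 $ 2)) x = (r^2 - 1) * pderiv_at 1 (\<lambda>y. 2 * p y * q y * t 1 y) x"
    by (rule second, erule pderiv_g(4)) (simp add: x)
  show ?thesis
    unfolding curlT_curl_def iter_pderiv_Cons iter_pderiv_Nil 11 12 22 by (simp only: algebra_simps)
qed

text \<open>\<open>\<alpha> = \<alpha>1 dx + \<alpha>2 dy\<close> is the connection form of the orthonormal coframe
  \<open>\<omega>1 = r (p dx + q dy)\<close>, \<open>\<omega>2 = -q dx + p dy\<close> of \<open>g\<close>.\<close>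

definition \<alpha>1 where "\<alpha>1 x = r * (p x * (p x * t 1 x + q x * t 2 x)) - 1/r * (q x * (p x * t 2 x - q x * t 1 x))"
definition \<alpha>2 where "\<alpha>2 x = r * (q x * (p x * t 1 x + q x * t 2 x)) + 1/r * (p x * (p x * t 2 x - q x * t 1 x))"

text \<open>Cartan's second structure equation: the exterior derivative of \<alpha> is minus the
  Gaussian curvature times the area form. Here \<open>det g\<close> is \<open>r^2\<close>, so the
  curvature is \<open>- curlT_curl g / (2 * r^2)\<close> and the area density is
  \<open>r\<close>.\<close>

lemma curl_connection:
  assumes x: "x \<in> \<Omega>"
  shows "pderiv_at 1 \<alpha>2 x - pderiv_at 2 \<alpha>1 x = curlT_curl g x / (2 * r)"
proof -
  have t12: "pderiv_at 2 (t 1) x = pderiv_at 1 (t 2) x" by (rule pderiv_t_commute[OF x])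
  \<comment> \<open>With \<open>s\<close> as a separate symbol both sides become polynomials;
    \<open>r * s = 1\<close> enters only through
    \<open>(r^2 - 1) / (2 * r) = (r - s) / 2\<close>.\<close>
  define s where "s = 1 / r"
  let ?X = "pderiv_at 2 (\<lambda>y. - 2 * p y * q y * t 2 y) x - 2 * pderiv_at 1 (\<lambda>y. (p y ^ 2 - q y ^ 2) * t 2 y) x
      + pderiv_at 1 (\<lambda>y. 2 * p y * q y * t 1 y) x"
  have X: "?X = 2 * (q x ^ 2 - p x ^ 2) * t 2 x * (t 2 x) 
     - 2 * p x * q x * pderiv_at 2 (t 2) x + 8 * p x * q x * t 1 x * t 2 x - 2 * (p x ^ 2 - q x ^ 2) * pderiv_at 1 (t 2) x
     + 2 * (p x ^ 2 - q x ^ 2) * t 1 x * t 1 x + 2 * p x * q x * pderiv_at 1 (t 1) x"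
    using x by (simp add: power2_eq_square pderiv_at_diff pderiv_at_minus pderiv_at_mult; simp add: algebra_simps)
  have 1: "pderiv_at 1 \<alpha>2 x = r * (p x * t 1 x * (p x * t 1 x + q x * t 2 x)
      + q x * (- q x * t 1 x * t 1 x + p x * pderiv_at 1 (t 1) x + p x * t 1 x * t 2 x + q x * pderiv_at 1 (t 2) x))
    + s * (- q x * t 1 x * (p x * t 2 x - q x * t 1 x)
      + p x * (- q x * t 1 x * t 2 x + p x * pderiv_at 1 (t 2) x - p x * t 1 x * t 1 x - q x * pderiv_at 1 (t 1) x))"
    unfolding \<alpha>2_def[abs_def] s_def[symmetric] using x
    by (simp add: pderiv_at_add pderiv_at_diff pderiv_at_mult; simp add: algebra_simps)
  have 2: "pderiv_at 2 \<alpha>1 x = r * (- q x * t 2 x * (p x * t 1 x + q x * t 2 x)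
      + p x * (- q x * t 2 x * t 1 x + p x * pderiv_at 1 (t 2) x + p x * t 2 x * t 2 x + q x * pderiv_at 2 (t 2) x))
    - s * (p x * t 2 x * (p x * t 2 x - q x * t 1 x)
      + q x * (- q x * t 2 x * t 2 x + p x * pderiv_at 2 (t 2) x - p x * t 2 x * t 1 x - q x * pderiv_at 1 (t 2) x))"
    unfolding \<alpha>1_def[abs_def] s_def[symmetric] using x
    by (simp add: pderiv_at_add pderiv_at_diff pderiv_at_mult t12; simp add: algebra_simps)
  have "(r^2 - 1) / (2 * r) = (r - s) / 2"
    using r_pos by (simp add: s_def field_simps power2_eq_square)
  moreover have "curlT_curl g x / (2 * r) = (r^2 - 1) / (2 * r) * ?X"
    unfolding curlT_curl_g[OF x] by (rule times_divide_eq_left[symmetric])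
  ultimately have "curlT_curl g x / (2 * r) = (r - s) / 2 * ?X" by (simp only:)
  also have "\<dots> = pderiv_at 1 \<alpha>2 x - pderiv_at 2 \<alpha>1 x"
    unfolding X 1 2 by (simp add: field_simps power2_eq_square)
  finally show ?thesis ..
qed

lemma smooth_connection: "smooth_on \<Omega> \<alpha>1" "smooth_on \<Omega> \<alpha>2"
  unfolding \<alpha>1_def[abs_def] \<alpha>2_def[abs_def]
  by (intro smooth_on_intros open_\<Omega> smooth_pq smooth_t)+

text \<open>Rotating the coframe by a potential of the connection form makes both of its forms closed.\<close>

lemma flat_coordinates:
  assumes sc: "simply_connected \<Omega>" and flat: "\<And>x. x \<in> \<Omega> \<Longrightarrow> curlT_curl g x = 0"
  shows "\<exists>u v. smooth_on \<Omega> u \<and> smooth_on \<Omega> v \<and>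
    (\<forall>x\<in>\<Omega>. \<forall>i j. pderiv_at i u x * pderiv_at j u x + pderiv_at i v x * pderiv_at j v x = g x $ i $ j)"
proof -
  have "pderiv_at 2 \<alpha>1 x = pderiv_at 1 \<alpha>2 x" if "x \<in> \<Omega>" for x
    using curl_connection[OF that] flat[OF that] by simp
  then obtain \<phi> where \<phi>: "smooth_on \<Omega> \<phi>"
    and d\<phi>: "\<And>x. x \<in> \<Omega> \<Longrightarrow> pderiv_at 1 \<phi> x = \<alpha>1 x" "\<And>x. x \<in> \<Omega> \<Longrightarrow> pderiv_at 2 \<phi> x = \<alpha>2 x"
    using poincare_lemma[OF open_\<Omega> sc smooth_connection] by blast
  define c s where "c = (\<lambda>x. cos (\<phi> x))" and "s = (\<lambda>x. sin (\<phi> x))"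
  have smooth_cs: "smooth_on \<Omega> c" "smooth_on \<Omega> s"
    unfolding c_def s_def by (intro smooth_on_intros open_\<Omega> \<phi>)+
  have d: "c differentiable at x" "s differentiable at x" "\<phi> differentiable at x" if "x \<in> \<Omega>" for x
    by (rule smooth_on_imp_differentiable[OF _ open_\<Omega> that], rule smooth_cs \<phi>)+
  have dc: "pderiv_at j c x = - s x * pderiv_at j \<phi> x" and ds: "pderiv_at j s x = c x * pderiv_at j \<phi> x"
    if "x \<in> \<Omega>" for j x
    unfolding c_def s_def
    by (rule pderiv_at_DERIV[OF DERIV_cos d(3)[OF that]], rule pderiv_at_DERIV[OF DERIV_sin d(3)[OF that]])
  \<comment> \<open>The components of \<alpha> along \<open>n\<close> and along
    \<open>(-q, p)\<close> are those of \<open>t\<close> scaled by \<open>r\<close> and by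
    \<open>1/r\<close>. These relations amount to the first structure equations of the
    coframe.\<close>
  have alpha: "p x * \<alpha>1 x + q x * \<alpha>2 x = r * (p x * t 1 x + q x * t 2 x)"
    "r * (p x * \<alpha>2 x - q x * \<alpha>1 x) = p x * t 2 x - q x * t 1 x" if "x \<in> \<Omega>" for x
  proof -
    have "p x * \<alpha>1 x + q x * \<alpha>2 x = (p x ^ 2 + q x ^ 2) * (r * (p x * t 1 x + q x * t 2 x))"
      unfolding \<alpha>1_def \<alpha>2_def by (simp add: algebra_simps power2_eq_square)
    then show "p x * \<alpha>1 x + q x * \<alpha>2 x = r * (p x * t 1 x + q x * t 2 x)"
      by (simp only: pq_unit[OF that] mult_1)
    have "r * (p x * \<alpha>2 x - q x * \<alpha>1 x) = (p x ^ 2 + q x ^ 2) * ((r * (1 / r)) * (p x * t 2 x - q x * t 1 x))"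
      unfolding \<alpha>1_def \<alpha>2_def by (simp only: algebra_simps power2_eq_square)
    then show "r * (p x * \<alpha>2 x - q x * \<alpha>1 x) = p x * t 2 x - q x * t 1 x"
      using r_pos by (simp add: pq_unit[OF that])
  qed
  \<comment> \<open>The form to integrate is \<open>c \<omega>1 - s \<omega>2\<close>; its curl is a
    combination of the two relations in \<open>alpha\<close>.\<close>
  have "\<exists>u. smooth_on \<Omega> u \<and> (\<forall>x\<in>\<Omega>. pderiv_at 1 u x = r * c x * p x + s x * q x \<and> pderiv_at 2 u x = r * c x * q x - s x * p x)"
  proof (rule poincare_lemma[OF open_\<Omega> sc])
    show "smooth_on \<Omega> (\<lambda>x. r * c x * p x + s x * q x)" "smooth_on \<Omega> (\<lambda>x. r * c x * q x - s x * p x)"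
      by (intro smooth_on_intros open_\<Omega> smooth_cs smooth_pq)+
    fix x assume x: "x \<in> \<Omega>"
    have "pderiv_at 2 (\<lambda>x. r * c x * p x + s x * q x) x - pderiv_at 1 (\<lambda>x. r * c x * q x - s x * p x) x
      = c x * ((p x * \<alpha>1 x + q x * \<alpha>2 x) - r * (p x * t 1 x + q x * t 2 x))
        - s x * (r * (p x * \<alpha>2 x - q x * \<alpha>1 x) - (p x * t 2 x - q x * t 1 x))"
      using x d by (simp add: pderiv_at_add pderiv_at_diff pderiv_at_mult dc ds d\<phi>; simp add: algebra_simps)
    then show "pderiv_at 2 (\<lambda>x. r * c x * p x + s x * q x) x = pderiv_at 1 (\<lambda>x. r * c x * q x - s x * p x) x"
      unfolding alpha[OF x] by simp
  qed
  then obtain u where u: "smooth_on \<Omega> u" and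
    du: "\<And>x. x \<in> \<Omega> \<Longrightarrow> pderiv_at 1 u x = r * c x * p x + s x * q x"
      "\<And>x. x \<in> \<Omega> \<Longrightarrow> pderiv_at 2 u x = r * c x * q x - s x * p x" by blast
  \<comment> \<open>The companion form is \<open>s \<omega>1 + c \<omega>2\<close>.\<close>
  have "\<exists>v. smooth_on \<Omega> v \<and> (\<forall>x\<in>\<Omega>. pderiv_at 1 v x = r * s x * p x - c x * q x \<and> pderiv_at 2 v x = r * s x * q x + c x * p x)"
  proof (rule poincare_lemma[OF open_\<Omega> sc])
    show "smooth_on \<Omega> (\<lambda>x. r * s x * p x - c x * q x)" "smooth_on \<Omega> (\<lambda>x. r * s x * q x + c x * p x)"
      by (intro smooth_on_intros open_\<Omega> smooth_cs smooth_pq)+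
    fix x assume x: "x \<in> \<Omega>"
    have "pderiv_at 2 (\<lambda>x. r * s x * p x - c x * q x) x - pderiv_at 1 (\<lambda>x. r * s x * q x + c x * p x) x
      = s x * ((p x * \<alpha>1 x + q x * \<alpha>2 x) - r * (p x * t 1 x + q x * t 2 x))
        + c x * (r * (p x * \<alpha>2 x - q x * \<alpha>1 x) - (p x * t 2 x - q x * t 1 x))"
      using x d by (simp add: pderiv_at_add pderiv_at_diff pderiv_at_mult dc ds d\<phi>; simp add: algebra_simps)
    then show "pderiv_at 2 (\<lambda>x. r * s x * p x - c x * q x) x = pderiv_at 1 (\<lambda>x. r * s x * q x + c x * p x) x"
      unfolding alpha[OF x] by simp
  qed
  then obtain v where v: "smooth_on \<Omega> v" and
    dv: "\<And>x. x \<in> \<Omega> \<Longrightarrow> pderiv_at 1 v x = r * s x * p x - c x * q x"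
      "\<And>x. x \<in> \<Omega> \<Longrightarrow> pderiv_at 2 v x = r * s x * q x + c x * p x" by blast
  \<comment> \<open>A rotation preserves the sum of squares, so the metric of \<open>(u, v)\<close>
    is \<open>\<omega>1^2 + \<omega>2^2\<close>, which is \<open>g\<close>; the rotation shows up
    only as the factor \<open>c^2 + s^2\<close>.\<close>
  have "pderiv_at i u x * pderiv_at j u x + pderiv_at i v x * pderiv_at j v x = g x $ i $ j" if x: "x \<in> \<Omega>" for x i j
  proof -
    have cs: "c x ^ 2 + s x ^ 2 = 1" by (simp add: c_def s_def)
    have pq: "q x ^ 2 = 1 - p x ^ 2" using pq_unit[OF x] by simp
    have "(r * c x * p x + s x * q x) * (r * c x * p x + s x * q x)
        + (r * s x * p x - c x * q x) * (r * s x * p x - c x * q x)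
        = (c x ^ 2 + s x ^ 2) * (r^2 * p x ^ 2 + q x ^ 2)"
      by (simp add: algebra_simps power2_eq_square)
    also have "\<dots> = 1 + (r^2 - 1) * p x ^ 2" unfolding cs pq by (simp add: algebra_simps)
    finally have 11: "(r * c x * p x + s x * q x) * (r * c x * p x + s x * q x)
        + (r * s x * p x - c x * q x) * (r * s x * p x - c x * q x) = \<dots>" .
    have "(r * c x * q x - s x * p x) * (r * c x * q x - s x * p x)
        + (r * s x * q x + c x * p x) * (r * s x * q x + c x * p x)
        = (c x ^ 2 + s x ^ 2) * ((r^2 - 1) * q x ^ 2 + (p x ^ 2 + q x ^ 2))"
      by (simp add: algebra_simps power2_eq_square)
    also have "\<dots> = 1 + (r^2 - 1) * q x ^ 2" unfolding cs pq_unit[OF x] by simp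
    finally have 22: "(r * c x * q x - s x * p x) * (r * c x * q x - s x * p x)
        + (r * s x * q x + c x * p x) * (r * s x * q x + c x * p x) = \<dots>" .
    have "(r * c x * p x + s x * q x) * (r * c x * q x - s x * p x)
        + (r * s x * p x - c x * q x) * (r * s x * q x + c x * p x)
        = (c x ^ 2 + s x ^ 2) * ((r^2 - 1) * (p x * q x))"
      by (simp add: algebra_simps power2_eq_square)
    then have 12: "(r * c x * p x + s x * q x) * (r * c x * q x - s x * p x)
        + (r * s x * p x - c x * q x) * (r * s x * q x + c x * p x) = (r^2 - 1) * (p x * q x)"
      unfolding cs by simp
    show ?thesis
      using exhaust_2[of i] exhaust_2[of j] 11 12 22
      by (elim disjE; simp only: du[OF x] dv[OF x] g_nth mult.commute)
  qed
  then show ?thesis using u v by blast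
qed

end

section \<open>Lifting to the slab\<close>

text \<open>The index types \<open>2\<close> and \<open>3\<close> are unrelated, so planar indices
  need an explicit embedding. By \<open>index3_cases\<close> every index of \<open>real^3\<close> is
  an embedded one or 3.\<close>

definition emb :: "2 \<Rightarrow> 3" where "emb i = (if i = 1 then 1 else 2)"

lemma emb_simps [simp]: "emb 1 = 1" "emb 2 = 2" "emb i \<noteq> 3" "3 \<noteq> emb i" "emb i = emb j \<longleftrightarrow> i = j"
  using exhaust_2[of i] exhaust_2[of j] by (auto simp: emb_def)

lemma index3_cases: obtains "i = 3" | j where "i = emb j"
  using exhaust_3[of i] emb_simps(1,2) by metis

lemma sum_emb: "(\<Sum>m\<in>UNIV. f m) = (\<Sum>m\<in>UNIV. f (emb m)) + f 3"
  by (simp add: sum_3 sum_2)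

lemma planar_part_nth [simp]: "planar_part x $ i = x $ emb i"
  using exhaust_2[of i] by (auto simp: planar_part_def)

lemma bounded_linear_planar_part: "bounded_linear planar_part"
  by (auto simp: linear_conv_bounded_linear[symmetric] vec_eq_iff intro!: linearI)

lemma has_derivative_planar_part: "(planar_part has_derivative planar_part) F"
  by (rule bounded_linear_imp_has_derivative[OF bounded_linear_planar_part])

lemma planar_part_axis: "planar_part (axis (emb k) 1) = axis k 1" "planar_part (axis 3 1) = 0"
  by (auto simp: vec_eq_iff axis_def)

lemma planar_part_in: "x \<in> slab \<Omega> \<Longrightarrow> planar_part x \<in> \<Omega>"
  by (simp add: slab_def)

lemma open_slab:
  assumes "open \<Omega>"
  shows "open (slab \<Omega>)"
proof -
  have "slab \<Omega> = planar_part -` \<Omega> \<inter> (\<lambda>x. x $ 3) -` {-1/2<..<1/2}"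
    by (auto simp: slab_def)
  moreover have "open (planar_part -` \<Omega>)"
    by (rule open_vimage[OF assms linear_continuous_on[OF bounded_linear_planar_part]])
  moreover have "open ((\<lambda>x::real^3. x $ 3) -` {-1/2<..<1/2})"
    by (intro open_vimage open_greaterThanLessThan continuous_intros)
  ultimately show ?thesis by auto
qed

lemma differentiable_planar:
  assumes "f differentiable at (planar_part x)"
  shows "(\<lambda>y. f (planar_part y)) differentiable at x"
  by (rule differentiableI[OF has_derivative_compose[OF has_derivative_planar_part
          assms[unfolded frechet_derivative_works]]])

lemma pderiv_planar:
  assumes "f differentiable at (planar_part x)"
  shows "pderiv_at (emb k) (\<lambda>y. f (planar_part y)) x = pderiv_at k f (planar_part x)"
    "pderiv_at 3 (\<lambda>y. f (planar_part y)) x = 0"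
  using linear_0[OF linear_frechet_derivative[OF assms]]
  by (subst pderiv_at_eq[OF has_derivative_compose[OF has_derivative_planar_part
          assms[unfolded frechet_derivative_works]]], simp add: planar_part_axis pderiv_at_def)+

text \<open>Functions of the planar part are closed under differentiation: planar derivatives act on
  \<open>f\<close>, and the third derivative gives the constant 0.\<close>

lemma smooth_on_planar:
  fixes f :: "real^2 \<Rightarrow> real"
  assumes \<Omega>: "open \<Omega>" and "smooth_on \<Omega> f"
  shows "smooth_on (slab \<Omega>) (\<lambda>x. f (planar_part x))"
proof (rule smooth_on_coinduct[where P = "\<lambda>h. \<exists>f. smooth_on \<Omega> f \<and> h = (\<lambda>x. f (planar_part x))"])
  fix h :: "real^3 \<Rightarrow> real" and x assume "\<exists>f. smooth_on \<Omega> f \<and> h = (\<lambda>x. f (planar_part x))" "x \<in> slab \<Omega>"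
  then show "h differentiable at x"
    using differentiable_planar smooth_on_imp_differentiable[OF _ \<Omega> planar_part_in] by blast
next
  fix h :: "real^3 \<Rightarrow> real" and k assume "\<exists>f. smooth_on \<Omega> f \<and> h = (\<lambda>x. f (planar_part x))"
  then obtain f where f: "smooth_on \<Omega> f" and h: "h = (\<lambda>x. f (planar_part x))" by blast
  note d = smooth_on_imp_differentiable[OF f \<Omega> planar_part_in]
  show "\<exists>g. (\<exists>f. smooth_on \<Omega> f \<and> g = (\<lambda>x. f (planar_part x))) \<and> (\<forall>x\<in>slab \<Omega>. g x = pderiv_at k h x)"
  proof (cases k rule: index3_cases)
    case 1
    show ?thesis
      by (intro exI[of _ "\<lambda>x::real^3. 0::real"] conjI exI[of _ "\<lambda>x::real^2. 0::real"])
        (simp_all add: 1 h pderiv_planar d smooth_on_const \<Omega>)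
  next
    case (2 j)
    show ?thesis
      by (intro exI[of _ "\<lambda>x. pderiv_at j f (planar_part x)"] conjI exI[of _ "pderiv_at j f"] smooth_on_pderiv f)
        (simp_all add: 2 h pderiv_planar d)
  qed
qed (use assms open_slab in auto)

lemma smooth_on_component:
  fixes S :: "(real^'k::finite) set"
  assumes "open S"
  shows "smooth_on S (\<lambda>x. x $ k)"
proof (rule smooth_on_pderivI[OF assms])
  show "(\<lambda>x. x $ k) differentiable at x" for x :: "real^'k"
    by (rule differentiableI[OF bounded_linear_imp_has_derivative[OF bounded_linear_vec_nth]])
  show "\<exists>g. smooth_on S g \<and> (\<forall>x\<in>S. g x = pderiv_at j (\<lambda>x. x $ k) x)" for j
    by (intro exI[of _ "\<lambda>x. if k = j then 1 else 0"]) (simp add: pderiv_at_component smooth_on_const assms)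
qed

section \<open>The three-dimensional metric on the slab\<close>

text \<open>The constant \<open>c\<close> stands for \<open>r powr (2 * \<delta>)\<close>. On the
  slab \<open>G3\<close> is \<open>c\<close> times the product of the planar metric \<open>g\<close>
  with the standard metric of the third axis.\<close>

locale planar_director_slab = planar_director +
  fixes c :: real and G3 :: "real^3 \<Rightarrow> real^3^3"
  assumes c_pos: "c > 0"
    and G3: "x \<in> slab \<Omega> \<Longrightarrow> G3 x = c *\<^sub>R (mat 1 + (r^2 - 1) *\<^sub>R
      (vector [n (planar_part x) $ 1, n (planar_part x) $ 2, 0] \<otimes> vector [n (planar_part x) $ 1, n (planar_part x) $ 2, 0]))"
begin

definition N :: "real^3 \<Rightarrow> real^3" where
  "N x = vector [n (planar_part x) $ 1, n (planar_part x) $ 2, 0]"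

lemma N_nth [simp]: "N x $ emb i = n (planar_part x) $ i" "N x $ 3 = 0"
  using exhaust_2[of i] by (auto simp: N_def)

lemma norm_N: "x \<in> slab \<Omega> \<Longrightarrow> norm (N x) = 1"
  using norm_n[OF planar_part_in] by (simp add: norm_eq_1 inner_vec_def sum_emb)

lemmas G3_N = G3[folded N_def]

lemma G3_nth:
  assumes "x \<in> slab \<Omega>"
  shows "G3 x $ emb a $ emb b = c * g (planar_part x) $ a $ b"
    "G3 x $ k $ 3 = (if k = 3 then c else 0)" "G3 x $ 3 $ k = (if k = 3 then c else 0)"
  by (simp_all add: G3_N[OF assms] g_def mat_def eq_commute[of 3])

lemma invertible_G3: "x \<in> slab \<Omega> \<Longrightarrow> invertible (G3 x)"
  unfolding G3_N using c_pos r_pos by (intro invertible_rank_one_update norm_N) auto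

lemma matrix_inv_G3:
  assumes "x \<in> slab \<Omega>"
  shows "matrix_inv (G3 x) $ emb a $ emb b = 1 / c * matrix_inv (g (planar_part x)) $ a $ b"
    "matrix_inv (G3 x) $ emb a $ 3 = 0" "matrix_inv (G3 x) $ 3 $ emb a = 0"
proof -
  have "matrix_inv (G3 x) = (1/c) *\<^sub>R (mat 1 + (1/r^2 - 1) *\<^sub>R (N x \<otimes> N x))"
    unfolding G3_N[OF assms] using c_pos r_pos by (intro matrix_inv_rank_one_update norm_N assms) auto
  then show "matrix_inv (G3 x) $ emb a $ emb b = 1 / c * matrix_inv (g (planar_part x)) $ a $ b"
    "matrix_inv (G3 x) $ emb a $ 3 = 0" "matrix_inv (G3 x) $ 3 $ emb a = 0"
    by (simp_all add: matrix_inv_g[OF planar_part_in[OF assms]] mat_def)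
qed

lemma pderiv_G3:
  assumes x: "x \<in> slab \<Omega>"
  shows "pderiv_at (emb j) (\<lambda>y. G3 y $ emb a $ emb b) x = c * pderiv_at j (\<lambda>y. g y $ a $ b) (planar_part x)"
    "pderiv_at 3 (\<lambda>y. G3 y $ k $ l) x = 0"
    "pderiv_at m (\<lambda>y. G3 y $ k $ 3) x = 0" "pderiv_at m (\<lambda>y. G3 y $ 3 $ k) x = 0"
proof -
  note S = open_slab[OF open_\<Omega>] x
  have d: "(\<lambda>y. g y $ a $ b) differentiable at (planar_part x)" for a b
    by (rule smooth_on_imp_differentiable[OF smooth_g open_\<Omega> planar_part_in[OF x]])
  have e: "pderiv_at m (\<lambda>y. G3 y $ emb a $ emb b) x = pderiv_at m (\<lambda>y. c * g (planar_part y) $ a $ b) x" for m a b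
    by (rule pderiv_at_cong[OF S G3_nth(1)])
  note pm = pderiv_at_mult[OF differentiable_const differentiable_planar[OF d]]
  show "pderiv_at (emb j) (\<lambda>y. G3 y $ emb a $ emb b) x = c * pderiv_at j (\<lambda>y. g y $ a $ b) (planar_part x)"
    unfolding e pm pderiv_planar(1)[OF d] by simp
  have z: "pderiv_at m (\<lambda>y. G3 y $ k $ 3) x = 0" "pderiv_at m (\<lambda>y. G3 y $ 3 $ k) x = 0" for m k
    using pderiv_at_cong[OF S G3_nth(2)] pderiv_at_cong[OF S G3_nth(3)] by simp_all
  then show "pderiv_at m (\<lambda>y. G3 y $ k $ 3) x = 0" "pderiv_at m (\<lambda>y. G3 y $ 3 $ k) x = 0" by blast+
  show "pderiv_at 3 (\<lambda>y. G3 y $ k $ l) x = 0"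
  proof (cases k rule: index3_cases)
    case (2 a)
    show ?thesis
    proof (cases l rule: index3_cases)
      case (2 b)
      show ?thesis unfolding \<open>k = emb a\<close> 2 e pm pderiv_planar(2)[OF d] by simp
    qed (simp add: z)
  qed (simp add: z)
qed

text \<open>The factor \<open>c\<close> of the derivatives cancels the \<open>1 / c\<close> of the
  inverse. An index 3 gives 0 because the metric is block diagonal, its last entry is constant and
  nothing depends on the third coordinate.\<close>

lemma christoffel_G3:
  assumes x: "x \<in> slab \<Omega>"
  shows "christoffel G3 (emb a) (emb b) (emb d) x = christoffel g a b d (planar_part x)"
    "christoffel G3 3 k l x = 0" "christoffel G3 k 3 l x = 0" "christoffel G3 k l 3 x = 0"
proof -
  show "christoffel G3 (emb a) (emb b) (emb d) x = christoffel g a b d (planar_part x)"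
  proof -
    have "1 / c * A * (c * B1 + c * B2 - c * B3) = A * (B1 + B2 - B3)" for A B1 B2 B3
      using c_pos by (simp add: field_simps)
    then show ?thesis
      unfolding christoffel_def sum_emb matrix_inv_G3[OF x] pderiv_G3[OF x] by simp
  qed
  show "christoffel G3 3 k l x = 0"
    unfolding christoffel_def sum_emb matrix_inv_G3[OF x] pderiv_G3[OF x] by simp
  show "christoffel G3 k 3 l x = 0" "christoffel G3 k l 3 x = 0"
    unfolding christoffel_def pderiv_G3[OF x] by simp_all
qed

lemma smooth_christoffel_G3: "smooth_on (slab \<Omega>) (christoffel G3 i k l)"
proof -
  note S = open_slab[OF open_\<Omega>]
  have z: ?thesis if "\<And>x. x \<in> slab \<Omega> \<Longrightarrow> christoffel G3 i k l x = 0"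
    by (rule smooth_on_cong[OF S _ smooth_on_const[OF S, of 0]]) (simp add: that)
  show ?thesis
  proof (cases i rule: index3_cases; cases k rule: index3_cases; cases l rule: index3_cases)
    fix a b d assume "i = emb a" "k = emb b" "l = emb d"
    then show ?thesis
      using smooth_on_cong[OF S christoffel_G3(1)[symmetric] smooth_on_planar[OF open_\<Omega> smooth_christoffel]]
      by blast
  qed (use z christoffel_G3 in blast)+
qed

lemma riemann_mixed_G3:
  assumes x: "x \<in> slab \<Omega>"
  shows "riemann_mixed G3 (emb s) (emb i) (emb j) (emb k) x = riemann_mixed g s i j k (planar_part x)"
    "riemann_mixed G3 3 i' j' k' x = 0"
proof -
  note S = open_slab[OF open_\<Omega>] x
  have d: "christoffel g a b d differentiable at (planar_part x)" for a b d
    by (rule smooth_on_imp_differentiable[OF smooth_christoffel open_\<Omega> planar_part_in[OF x]])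
  have p: "pderiv_at (emb m) (christoffel G3 (emb a) (emb b) (emb d)) x
      = pderiv_at m (christoffel g a b d) (planar_part x)" for m a b d
    using pderiv_at_cong[OF S christoffel_G3(1)] pderiv_planar(1)[OF d] by simp
  show "riemann_mixed G3 (emb s) (emb i) (emb j) (emb k) x = riemann_mixed g s i j k (planar_part x)"
    unfolding riemann_mixed_def sum_emb p christoffel_G3[OF x] by simp
  have z: "pderiv_at m (christoffel G3 3 a b) x = 0" for m a b
    using pderiv_at_cong[OF S christoffel_G3(2)] by simp
  show "riemann_mixed G3 3 i' j' k' x = 0"
    unfolding riemann_mixed_def z christoffel_G3(2)[OF x] by simp
qed

lemma riemann_G3: "x \<in> slab \<Omega> \<Longrightarrow> riemann G3 1 2 1 2 x = c * riemann g 1 2 1 2 (planar_part x)"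
  using riemann_mixed_G3(1)[of x _ 2 1 2] G3_nth(1)[of x 1] G3_nth(3)[of x 1]
  by (simp add: riemann_def sum_emb riemann_mixed_G3(2) sum_distrib_left mult.assoc)

text \<open>Curvatures with upper index 3 vanish identically for such a product, so the condition is
  carried by \<open>R\<^sub>1\<^sub>2\<^sub>1\<^sub>2\<close>, which equals
  \<open>- c * curlT_curl g / 2\<close> at the planar part.\<close>

lemma curvatures_zero_iff:
  "(\<forall>x\<in>slab \<Omega>. riemann_mixed G3 3 1 1 2 x = 0 \<and> riemann_mixed G3 3 2 2 1 x = 0 \<and> riemann G3 1 2 1 2 x = 0)
    \<longleftrightarrow> (\<forall>x\<in>\<Omega>. curlT_curl g x = 0)" (is "?L \<longleftrightarrow> ?R")
proof
  assume ?L
  show ?R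
  proof
    fix x assume x: "x \<in> \<Omega>"
    \<comment> \<open>Points of \<Omega> are lifted to the middle slice of the slab.\<close>
    define z :: "real^3" where "z = vector [x $ 1, x $ 2, 0]"
    have pz: "planar_part z = x" by (simp add: vec_eq_iff forall_2 z_def)
    then have "z \<in> slab \<Omega>" using x by (simp add: slab_def z_def)
    then show "curlT_curl g x = 0"
      using \<open>?L\<close> riemann_G3[of z] pz riemann_g[OF x] c_pos by auto
  qed
next
  assume ?R then show ?L
    by (simp add: riemann_mixed_G3(2) riemann_G3 riemann_g planar_part_in)
qed

text \<open>An immersion between equal dimensions forces all curvatures to vanish, in particular
  \<open>R\<^sub>1\<^sub>2\<^sub>1\<^sub>2\<close>. Conversely, planar flat coordinates extend to
  the slab.\<close>

lemma immersable_iff: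
  assumes "simply_connected \<Omega>"
  shows "immersable (slab \<Omega>) G3 \<longleftrightarrow> (\<forall>x\<in>\<Omega>. curlT_curl g x = 0)"
proof
  note S = open_slab[OF open_\<Omega>]
  assume "immersable (slab \<Omega>) G3"
  then obtain u :: "real^3 \<Rightarrow> real^3" where "smooth_on (slab \<Omega>) u \<and> (\<forall>x\<in>slab \<Omega>. G3 x =
      transpose (matrix (frechet_derivative u (at x))) ** matrix (frechet_derivative u (at x)))"
    unfolding immersable_def by (rule exE)
  then have u: "smooth_on (slab \<Omega>) u" "\<And>x. x \<in> slab \<Omega> \<Longrightarrow> G3 x =
      transpose (matrix (frechet_derivative u (at x))) ** matrix (frechet_derivative u (at x))"
    by simp_all
  have "riemann_mixed G3 s i j k x = 0" if "x \<in> slab \<Omega>" for s i j k x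
    using riemann_mixed_pullback[OF S u invertible_G3 smooth_on_imp_differentiable[OF smooth_christoffel_G3 S] that]
    by blast
  then show "\<forall>x\<in>\<Omega>. curlT_curl g x = 0"
    by (subst curvatures_zero_iff[symmetric]) (simp add: riemann_def)
next
  note S = open_slab[OF open_\<Omega>]
  assume "\<forall>x\<in>\<Omega>. curlT_curl g x = 0"
  then obtain u v where u: "smooth_on \<Omega> u" and v: "smooth_on \<Omega> v"
    and uv: "\<And>x i j. x \<in> \<Omega> \<Longrightarrow>
      pderiv_at i u x * pderiv_at j u x + pderiv_at i v x * pderiv_at j v x = g x $ i $ j"
    using flat_coordinates[OF assms] by blast
  define s where "s = sqrt c"
  have ss: "s * s = c" using c_pos by (simp add: s_def)
  \<comment> \<open>The flat coordinates of \<open>g\<close>, completed by the third coordinate; the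
    dilation by \<open>sqrt c\<close> produces the factor \<open>c\<close> of the metric.\<close>
  define w :: "real^3 \<Rightarrow> real^3" where
    "w x = vector [s * u (planar_part x), s * v (planar_part x), s * x $ 3]" for x
  have w_nth: "w x $ 1 = s * u (planar_part x)" "w x $ 2 = s * v (planar_part x)" "w x $ 3 = s * x $ 3" for x
    by (simp_all add: w_def)
  have "smooth_on (slab \<Omega>) (\<lambda>x. w x $ i)" for i
    using exhaust_3[of i]
    by (elim disjE; simp only: w_nth; intro smooth_on_mult smooth_on_const smooth_on_planar smooth_on_component open_\<Omega> S u v)
  then have w: "smooth_on (slab \<Omega>) w" by (rule smooth_on_componentwise[OF S])
  have "G3 x = transpose (matrix (frechet_derivative w (at x))) ** matrix (frechet_derivative w (at x))"
    if x: "x \<in> slab \<Omega>" for x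
  proof -
    note px = planar_part_in[OF x]
    note du = smooth_on_imp_differentiable[OF u open_\<Omega> px] and dv = smooth_on_imp_differentiable[OF v open_\<Omega> px]
    have J: "pderiv_at k w x $ i = pderiv_at k (\<lambda>y. w y $ i) x" for k i
      by (rule pderiv_at_nth[OF smooth_on_imp_differentiable[OF w S x], symmetric])
    have J1: "pderiv_at k w x $ 1 = s * pderiv_at k (\<lambda>y. u (planar_part y)) x" for k
      unfolding J w_nth using pderiv_at_mult[OF differentiable_const differentiable_planar[OF du]] by simp
    have J2: "pderiv_at k w x $ 2 = s * pderiv_at k (\<lambda>y. v (planar_part y)) x" for k
      unfolding J w_nth using pderiv_at_mult[OF differentiable_const differentiable_planar[OF dv]] by simp
    have J3: "pderiv_at k w x $ 3 = s * (if 3 = k then 1 else 0)" for k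
      unfolding J w_nth using pderiv_at_mult[OF differentiable_const
          smooth_on_imp_differentiable[OF smooth_on_component S x, OF S], of k s 3]
      by (simp add: pderiv_at_component)
    have "(transpose (matrix (frechet_derivative w (at x))) ** matrix (frechet_derivative w (at x))) $ k $ l
       = pderiv_at k w x \<bullet> pderiv_at l w x" for k l
      by (simp add: matrix_matrix_mult_def transpose_def inner_vec_def column_jacobian[symmetric] column_def)
    also have "pderiv_at k w x \<bullet> pderiv_at l w x
      = c * (pderiv_at k (\<lambda>y. u (planar_part y)) x * pderiv_at l (\<lambda>y. u (planar_part y)) x
           + pderiv_at k (\<lambda>y. v (planar_part y)) x * pderiv_at l (\<lambda>y. v (planar_part y)) x
           + (if 3 = k \<and> 3 = l then 1 else 0))" for k l
      by (simp add: inner_vec_def sum_3 J1 J2 J3 ss[symmetric] algebra_simps)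
    also have "\<dots> k l = G3 x $ k $ l" for k l
      by (cases k rule: index3_cases; cases l rule: index3_cases)
        (simp_all add: pderiv_planar[OF du] pderiv_planar[OF dv] uv[OF px] G3_nth[OF x])
    finally show ?thesis by (simp add: vec_eq_iff)
  qed
  then show "immersable (slab \<Omega>) G3" unfolding immersable_def using w by blast
qed

end

section \<open>Equivalence of the four conditions\<close>

theorem theorem8p1:
  fixes \<Omega> :: "(real^2) set" and \<Lambda> \<nu> r \<delta> :: real
    and nvec :: "real^2 \<Rightarrow> real^3" and n :: "real^2 \<Rightarrow> real^2"
    and G :: "real^2 \<Rightarrow> real^3^3" and G3 :: "real^3 \<Rightarrow> real^3^3"
  assumes "open \<Omega>" "bounded \<Omega>" "smooth_boundary \<Omega>" "simply_connected \<Omega>"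
    and "\<Lambda> \<in> {0<..<1} \<union> {1<..}" and "1/2 < \<nu>" "\<nu> < 2"
    and "r = \<Lambda> powr (\<nu> + 1)" and "\<delta> = - \<nu> / (\<nu> + 1)"
    and "smooth_on_closure \<Omega> nvec" and "\<And>x. x \<in> closure \<Omega> \<Longrightarrow> norm (nvec x) = 1"
    and "\<And>x. x \<in> closure \<Omega> \<Longrightarrow> nvec x = vector [n x $ 1, n x $ 2, 0]"
    and "n ` closure \<Omega> \<subseteq> sphere 0 1"
    and "G = (\<lambda>x. r powr (2 * \<delta>) *\<^sub>R (mat 1 + (r^2 - 1) *\<^sub>R (nvec x \<otimes> nvec x)))"
    and "G3 = (\<lambda>x. G (planar_part x))"
  shows "(immersable (slab \<Omega>) G3 \<longleftrightarrow>
            (\<forall>x\<in>\<Omega>. gauss_curvature (\<lambda>y. mat 1 + (r^2 - 1) *\<^sub>R (n y \<otimes> n y)) x = 0)) \<and>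
         ((\<forall>x\<in>\<Omega>. gauss_curvature (\<lambda>y. mat 1 + (r^2 - 1) *\<^sub>R (n y \<otimes> n y)) x = 0) \<longleftrightarrow>
            (\<forall>x\<in>\<Omega>. curlT_curl (\<lambda>y. principal_block (G y)) x = 0)) \<and>
         ((\<forall>x\<in>\<Omega>. curlT_curl (\<lambda>y. principal_block (G y)) x = 0) \<longleftrightarrow>
            (\<forall>x\<in>slab \<Omega>. riemann_mixed G3 3 1 1 2 x = 0 \<and> riemann_mixed G3 3 2 2 1 x = 0 \<and>
                         riemann G3 1 2 1 2 x = 0))"
proof -
  define c where "c = r powr (2 * \<delta>)"
  have r: "r > 0" using assms(5,8) by auto
  have nv: "nvec x = vector [n x $ 1, n x $ 2, 0]" if "x \<in> \<Omega>" for x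
    using assms(12) that closure_subset by blast
  \<comment> \<open>Smoothness is given for \<open>nvec\<close>; \<open>n\<close> inherits it on
    \<Omega>, where its components agree with the first two of \<open>nvec\<close>.\<close>
  have "smooth_on \<Omega> (\<lambda>x. n x $ i)" for i
  proof (rule smooth_on_cong[OF assms(1)])
    show "smooth_on \<Omega> (\<lambda>x. nvec x $ emb i)"
      by (rule smooth_on_nth[OF assms(1)]) (use assms(10) in \<open>simp add: smooth_on_closure_def\<close>)
    show "nvec x $ emb i = n x $ i" if "x \<in> \<Omega>" for x
      using exhaust_2[of i] by (auto simp: nv[OF that])
  qed
  then have "smooth_on \<Omega> n" by (rule smooth_on_componentwise[OF assms(1)])
  moreover have "norm (n x) = 1" if "x \<in> \<Omega>" for x
  proof -
    have "n x \<in> sphere 0 1" using assms(13) that closure_subset[of \<Omega>] by blast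
    then show ?thesis by simp
  qed
  ultimately interpret planar_director_slab \<Omega> n r c G3
    using assms(1) r by unfold_locales (auto simp: assms(14,15) c_def nv planar_part_in)
  have g: "(\<lambda>y. mat 1 + (r^2 - 1) *\<^sub>R (n y \<otimes> n y)) = g"
    by (simp add: g_def fun_eq_iff)
  have "curlT_curl (\<lambda>y. principal_block (G y)) x = c * curlT_curl g x" if x: "x \<in> \<Omega>" for x
  proof -
    \<comment> \<open>On \<Omega> the principal block of \<open>G\<close> is \<open>c\<close> times
      \<open>g\<close>, and the constant passes through both derivatives.\<close>
    have scaled: "iter_pderiv [k, l] f x = c * iter_pderiv [k, l] (\<lambda>y. g y $ a $ b) x"
      if f: "\<And>y. y \<in> \<Omega> \<Longrightarrow> f y = c * g y $ a $ b" for k l a b f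
    proof -
      have "pderiv_at l f y = c * pderiv_at l (\<lambda>y. g y $ a $ b) y" if y: "y \<in> \<Omega>" for y
        using pderiv_at_cong[OF assms(1) y f] smooth_on_imp_differentiable[OF smooth_g assms(1) y]
        by (simp add: pderiv_at_mult)
      then show ?thesis
        using pderiv_at_cong[OF assms(1) x, of "pderiv_at l f"]
          smooth_on_imp_differentiable[OF smooth_on_pderiv[OF smooth_g] assms(1) x]
        by (simp add: pderiv_at_mult)
    qed
    have G: "principal_block (G y) $ i $ j = c * g y $ i $ j" if "y \<in> \<Omega>" for y i j
      using exhaust_2[of i] exhaust_2[of j]
      by (auto simp: assms(14) nv[OF that] c_def mat_def power2_eq_square)
    have "iter_pderiv [k, l] (\<lambda>y. principal_block (G y) $ a $ b) x = c * iter_pderiv [k, l] (\<lambda>y. g y $ a $ b) x"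
      for k l a b
      by (rule scaled) (rule G)
    then show ?thesis
      unfolding curlT_curl_def by (simp only: algebra_simps)
  qed
  then have "(\<forall>x\<in>\<Omega>. curlT_curl (\<lambda>y. principal_block (G y)) x = 0) \<longleftrightarrow> (\<forall>x\<in>\<Omega>. curlT_curl g x = 0)"
    using c_pos by simp
  then show ?thesis
    unfolding g using immersable_iff[OF assms(4)] curvatures_zero_iff gauss_curvature_zero_iff by simp
qed

end
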